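(* Let $(\Omega,\mathcal{F},\mu)$ be a positive Borel measure space and suppose that $(\Omega^n,d_{\mathrm{Ham}})$ is $\Psi$-dominated with respect to $\mu$ (for each $n\ge 1$). Let $X_1,X_2,\ldots$ be a random process with values in $\Omega$ defined on the measure space $(\Omega^{\mathbb{N}},\mathcal{F}^{\mathbb{N}},\mathbf{P})$, and assume that for all $n\ge1$ we have $\mathbf{P}_n\ll\mu^n$, where $\mathbf{P}_n$ is the marginal distribution of $(X_1,\ldots,X_n)$ and $\mu^n$ is the corresponding product measure on $(\Omega^n,\mathcal{F}^n)$. Suppose further that the empirical measure defined by $$\hat P_n(A)=\frac1n\sum_{i=1}^n\mathbf{1}\{X_i\in A\},\qquad A\in\mathcal{F},$$ has uniformly converging expectation, i.e. for some measure $\nu$ on $(\Omega,\mathcal{F})$, $$\lim_{n\to\infty}\big\|\mathbf{E}\hat P_n(\cdot)-\nu(\cdot)\big\|_{TV}=0,$$ and define $n_0=n_0(\varepsilon)$ to be such that $\|\mathbf{E}\hat P_n(\cdot)-\nu(\cdot)\|_{TV}<\varepsilon$ for all $n>n_0(\varepsilon)$. Then $\hat P_n(A)$ converges to $\nu(A)$ almost surely, exponentially fast: $$\mathbf{P}_n\big\{|\hat P_n(A)-\nu(A)|>t+\varepsilon\big\}\;\le\;2\exp\!\left(-\frac{n t^2}{2\|\Delta_n\|_\infty^2}\right)$$ for all $n>n_0(\varepsilon)$, where $\Delta_n$ is the $\eta$-mixing matrix of $(X_1,\ldots,X_n)$. (Here $A\in\mathcal{F}$ and $t,\varepsilon>0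$.)
   Context: $\mu^k=\mu\otimes\cdots\otimes\mu$ ($k$ factors) on $\Omega^k$. The Hamming metric on $\Omega^n$ is $d_{\mathrm{Ham}}(x,y)=\sum_{i=1}^n\mathbf{1}\{x_i\ne y_i\}$. The total variation norm of a signed measure $\tau$ is $\|\tau\|_{TV}=\frac12[\sup_A\tau(A)-\inf_A\tau(A)]$. $\Psi$-dominance. Let $F_k=L_1(\Omega^k,\mathcal{F}^k,\mu^k)$ and $z_+=z\,\mathbf{1}\{z>0\}$. Define $\pi:F_k\to F_{k-1}$ by $(\pi f)(x_2,\ldots,x_k)=\int_\Omega f(x_1,x_2,\ldots,x_k)\,d\mu(x_1)$, and $\Psi_k:F_k\to\mathbb{R}$ recursively by $\Psi_0=0$, $\Psi_k(f)=\Psi_{k-1}(\pi f)+\int_{\Omega^k}(f(x))_+\,d\mu^k(x)$ for $k\ge1$. For a metric $\rho$ on $\Omega^n$ let $\Phi_n\subset F_n$ be the set of all measurable $g:\Omega^n\to[0,\mathrm{diam}_\rho(\Omega^n)]$ with $|g(x)-g(y)|\le\rho(x,y)$ for all $x,y$, where $\mathrm{diam}_\rho(\Omega^n)=\sup_{x,y}\rho(x,y)$. The metric space $(\Omega^n,\rho)$ is $\Psi$-dominated with respect to $\mu$ if $\sup_{g\in\Phi_n}\int_{\Omega^n}f g\,d\mu^n\le\Psi_n(f)$ for all $f\in F_n$. $\eta$-mixing matrix. Write $X_{j:n}=(X_j,\ldots,X_n)$, and let $\mathcal{L}(X_{j:n}\mid X_{1:i}=x)$ be the law of $X_{j:n}$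 conditioned on $X_{1:i}=x$. For $1\le i<j\le n$, $y\in\Omega^{i-1}$, $w,w'\in\Omega$ let $$\eta_{ij}(y,w,w')=\big\|\mathcal{L}(X_{j:n}\mid X_{1:i}=(y,w))-\mathcal{L}(X_{j:n}\mid X_{1:i}=(y,w'))\big\|_{TV},$$ and let $\bar\eta_{ij}$ be the essential supremum of $\eta_{ij}(y,w,w')$ over $y\in\Omega^{i-1}$, $w,w'\in\Omega$, taken with respect to $\mu$. To handle conditioning on sets of measure zero, the following convention is used: for an arbitrary probability measure $m$ on $\Omega^n$, $\bar\eta_{ij}(m)=\inf\lim_{k\to\infty}\bar\eta_{ij}(m_k)$, the infimum being over all sequences $\{m_k\}$ of strictly positive probability measures on $\Omega^n$ ($m_k(x)>0$ for all $x\in\Omega^n$) with $\|m_k-m\|_{TV}\to0$. $\Delta_n$ is the upper-triangular $n\times n$ matrix with $(\Delta_n)_{ii}=1$ and $(\Delta_n)_{ij}=\bar\eta_{ij}$ for $i<j$, and $\|\Delta_n\|_\infty=\max_{1\le i<n}\big(1+\bar\eta_{i,i+1}+\cdots+\bar\eta_{i,n}\big)$ is its $\ell_\infty$ operator norm.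
   Formalization: The measure μ is taken sigma-finite, and almost sure convergence is claimed only when exp(-nt²/(2‖Δ_n‖²)) is summable in n for every t>0; without this it fails (X_i = X_1 uniform on {0,1}). The displayed bound is unrestricted. *)

theory Defs
  imports "HOL-Probability.Probability"
begin

text \<open>Coordinates are numbered from 1, so a point of \<open>\<Omega>\<^sup>n\<close> is a function that is
  extensional on \<open>{1..n}\<close>.\<close>

abbreviation pow_measure :: "'a measure \<Rightarrow> nat \<Rightarrow> (nat \<Rightarrow> 'a) measure" where
  "pow_measure \<mu> n \<equiv> PiM {1..n} (\<lambda>_. \<mu>)"

definition hamming :: "nat \<Rightarrow> (nat \<Rightarrow> 'a) \<Rightarrow> (nat \<Rightarrow> 'a) \<Rightarrow> real" where
  "hamming n x y = (\<Sum>i=1..n. if x i \<noteq> y i then 1 else 0)"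

text \<open>The norm is extended-real valued, which makes it meaningful before any boundedness of the
  set function \<open>\<tau>\<close> is known. If \<open>\<tau> {} = 0\<close>, the supremum is nonnegative and the
  infimum nonpositive, so the difference is never of the form \<open>\<infinity> - \<infinity>\<close>.\<close>

definition tv_norm :: "'a measure \<Rightarrow> ('a set \<Rightarrow> real) \<Rightarrow> ereal" where
  "tv_norm M \<tau> = ((SUP A\<in>sets M. ereal (\<tau> A)) - (INF A\<in>sets M. ereal (\<tau> A))) / 2"

subsection \<open>\<open>\<Psi>\<close>-dominance\<close>

text \<open>\<open>marg_first \<mu> k\<close> maps functions on \<open>\<Omega>\<^bsup>k+1\<^esup>\<close> to functions on \<open>\<Omega>\<^bsup>k\<^esup>\<close>;
  the remaining coordinates \<open>2, \<dots>, k + 1\<close> are renumbered to \<open>1, \<dots>, k\<close>.\<close>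

definition marg_first :: "'a measure \<Rightarrow> nat \<Rightarrow> ((nat \<Rightarrow> 'a) \<Rightarrow> real) \<Rightarrow> (nat \<Rightarrow> 'a) \<Rightarrow> real" where
  "marg_first \<mu> k f y =
     (\<integral>x. f (\<lambda>i\<in>{1..Suc k}. if i = 1 then x else y (i - 1)) \<partial>\<mu>)"

primrec Psi :: "'a measure \<Rightarrow> nat \<Rightarrow> ((nat \<Rightarrow> 'a) \<Rightarrow> real) \<Rightarrow> real" where
  "Psi \<mu> 0 f = 0"
| "Psi \<mu> (Suc k) f = Psi \<mu> k (marg_first \<mu> k f) + (\<integral>x. max 0 (f x) \<partial>pow_measure \<mu> (Suc k))"

definition diam :: "'b set \<Rightarrow> ('b \<Rightarrow> 'b \<Rightarrow> real) \<Rightarrow> ereal" where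
  "diam S \<rho> = (SUP x\<in>S. SUP y\<in>S. ereal (\<rho> x y))"

definition Phi :: "'a measure \<Rightarrow> nat \<Rightarrow> ((nat \<Rightarrow> 'a) \<Rightarrow> (nat \<Rightarrow> 'a) \<Rightarrow> real) \<Rightarrow> ((nat \<Rightarrow> 'a) \<Rightarrow> real) set" where
  "Phi \<mu> n \<rho> = {g. integrable (pow_measure \<mu> n) g
     \<and> (\<forall>x\<in>space (pow_measure \<mu> n). 0 \<le> g x \<and> ereal (g x) \<le> diam (space (pow_measure \<mu> n)) \<rho>)
     \<and> (\<forall>x\<in>space (pow_measure \<mu> n). \<forall>y\<in>space (pow_measure \<mu> n). \<bar>g x - g y\<bar> \<le> \<rho> x y)}"

definition Psi_dominated :: "'a measure \<Rightarrow> nat \<Rightarrow> ((nat \<Rightarrow> 'a) \<Rightarrow> (nat \<Rightarrow> 'a) \<Rightarrow> real) \<Rightarrow> bool" where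
  "Psi_dominated \<mu> n \<rho> \<longleftrightarrow>
     (\<forall>f. integrable (pow_measure \<mu> n) f \<longrightarrow>
        (SUP g\<in>Phi \<mu> n \<rho>. ereal (\<integral>x. f x * g x \<partial>pow_measure \<mu> n)) \<le> ereal (Psi \<mu> n f))"

subsection \<open>The \<open>\<eta>\<close>-mixing matrix\<close>

text \<open>A strictly positive probability measure on \<open>\<Omega>\<^sup>n\<close> is given by its density \<open>p\<close> with
  respect to \<open>\<mu>\<^sup>n\<close>. For counting measure \<open>\<mu>\<close> this is its probability mass function.\<close>

definition pos_pdf :: "'a measure \<Rightarrow> nat \<Rightarrow> ((nat \<Rightarrow> 'a) \<Rightarrow> real) \<Rightarrow> bool" where
  "pos_pdf \<mu> n p \<longleftrightarrow> p \<in> borel_measurable (pow_measure \<mu> n)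
     \<and> (\<forall>x\<in>space (pow_measure \<mu> n). 0 < p x)
     \<and> prob_space (density (pow_measure \<mu> n) (\<lambda>x. ennreal (p x)))"

text \<open>\<open>cond_law \<mu> n p i j x\<close> is the law of \<open>X\<^bsub>j:n\<^esub>\<close> given \<open>X\<^bsub>1:i\<^esub> = x\<close>
  when \<open>(X\<^sub>1, \<dots>, X\<^sub>n)\<close> has density \<open>p\<close>: the conditional density of \<open>X\<^bsub>i+1:n\<^esub>\<close> at
  \<open>u\<close> is \<open>p(x, u) / \<integral> p(x, v) dv\<close>, and the law is then projected to the coordinates
  \<open>j, \<dots>, n\<close>. For \<open>\<mu>\<^sup>i\<close>-almost every \<open>x\<close> the denominator is finite and positive.\<close>

definition cond_law :: "'a measure \<Rightarrow> nat \<Rightarrow> ((nat \<Rightarrow> 'a) \<Rightarrow> real) \<Rightarrow> nat \<Rightarrow> nat \<Rightarrow> (nat \<Rightarrow> 'a) \<Rightarrow> (nat \<Rightarrow> 'a) measure" where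
  "cond_law \<mu> n p i j x =
     distr
       (density (PiM {i<..n} (\<lambda>_. \<mu>))
          (\<lambda>u. ennreal (p (merge {1..i} {i<..n} (x, u))
                 / (\<integral>v. p (merge {1..i} {i<..n} (x, v)) \<partial>PiM {i<..n} (\<lambda>_. \<mu>)))))
       (PiM {j..n} (\<lambda>_. \<mu>))
       (\<lambda>u. restrict u {j..n})"

definition eta_cond ::
  "'a measure \<Rightarrow> nat \<Rightarrow> ((nat \<Rightarrow> 'a) \<Rightarrow> real) \<Rightarrow> nat \<Rightarrow> nat \<Rightarrow> (nat \<Rightarrow> 'a) \<Rightarrow> 'a \<Rightarrow> 'a \<Rightarrow> ereal" where
  "eta_cond \<mu> n p i j y w w' =
     tv_norm (PiM {j..n} (\<lambda>_. \<mu>))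
       (\<lambda>B. measure (cond_law \<mu> n p i j (y(i := w))) B - measure (cond_law \<mu> n p i j (y(i := w'))) B)"

text \<open>The essential supremum is written out as in \<open>esssup_eq_AE\<close>; unlike the constant
  \<open>esssup\<close>, this form does not default to \<open>\<infinity>\<close> when measurability is not at hand.\<close>

definition eta_bar_pos :: "'a measure \<Rightarrow> nat \<Rightarrow> ((nat \<Rightarrow> 'a) \<Rightarrow> real) \<Rightarrow> nat \<Rightarrow> nat \<Rightarrow> ereal" where
  "eta_bar_pos \<mu> n p i j =
     Inf {c. AE (y, w, w') in PiM {1..<i} (\<lambda>_. \<mu>) \<Otimes>\<^sub>M (\<mu> \<Otimes>\<^sub>M \<mu>). eta_cond \<mu> n p i j y w w' \<le> c}"

definition eta_bar :: "'a measure \<Rightarrow> nat \<Rightarrow> (nat \<Rightarrow> 'a) measure \<Rightarrow> nat \<Rightarrow> nat \<Rightarrow> ereal" where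
  "eta_bar \<mu> n m i j =
     Inf {L. \<exists>p. (\<forall>k. pos_pdf \<mu> n (p k))
       \<and> (\<lambda>k. tv_norm (pow_measure \<mu> n)
                (\<lambda>A. measure (density (pow_measure \<mu> n) (\<lambda>x. ennreal (p k x))) A - measure m A))
            \<longlonglongrightarrow> 0
       \<and> (\<lambda>k. eta_bar_pos \<mu> n (p k) i j) \<longlonglongrightarrow> L}"

definition Delta :: "'a measure \<Rightarrow> nat \<Rightarrow> (nat \<Rightarrow> 'a) measure \<Rightarrow> nat \<Rightarrow> nat \<Rightarrow> real" where
  "Delta \<mu> n m i j =
     (if i = j then 1 else if i < j then real_of_ereal (eta_bar \<mu> n m i j) else 0)"

text \<open>The \<open>\<ell>\<^sub>\<infinity>\<close> operator norm of an \<open>n \<times> n\<close> matrix is its maximal absolute row sum.\<close>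

definition linf_norm :: "nat \<Rightarrow> (nat \<Rightarrow> nat \<Rightarrow> real) \<Rightarrow> real" where
  "linf_norm n D = Max ((\<lambda>i. \<Sum>j=1..n. \<bar>D i j\<bar>) ` {1..n})"

lemma tv_norm_nonneg:
  assumes "\<tau> {} = 0"
  shows "0 \<le> tv_norm M \<tau>"
proof -
  have "(0::ereal) \<le> (SUP A\<in>sets M. ereal (\<tau> A))"
    by (rule SUP_upper2[of "{}"]) (auto simp: assms)
  moreover have "(INF A\<in>sets M. ereal (\<tau> A)) \<le> 0"
    by (rule INF_lower2[of "{}"]) (auto simp: assms)
  ultimately have "0 \<le> (SUP A\<in>sets M. ereal (\<tau> A)) - (INF A\<in>sets M. ereal (\<tau> A))"
    by (meson ereal_diff_positive order_trans)
  then show ?thesis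
    unfolding tv_norm_def by (simp add: zero_le_divide_ereal)
qed

lemma real_eta_bar_nonneg: "0 \<le> real_of_ereal (eta_bar \<mu> n m i j)"
proof -
  let ?M = "PiM {1..<i} (\<lambda>_. \<mu>) \<Otimes>\<^sub>M (\<mu> \<Otimes>\<^sub>M \<mu>)"
  have nn: "0 \<le> eta_cond \<mu> n p i j y w w'" for p y w w'
    unfolding eta_cond_def by (rule tv_norm_nonneg) simp
  show ?thesis
  proof (cases "emeasure ?M (space ?M) = 0")
    case True
    have "AE v in ?M. Q v" for Q
      using True by (intro AE_I[of _ _ "space ?M"]) auto
    then have bot: "eta_bar_pos \<mu> n p i j = - \<infinity>" for p
      unfolding eta_bar_pos_def by (simp add: bot_ereal_def[symmetric])
    have "L = - \<infinity>" if "(\<lambda>k::nat. eta_bar_pos \<mu> n (p k) i j) \<longlonglongrightarrow> L" for p L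
      using that by (simp add: bot LIMSEQ_const_iff)
    then have "eta_bar \<mu> n m i j \<in> {Inf {}, Inf {- \<infinity>}}"
      unfolding eta_bar_def by (smt (verit, best) Collect_empty_eq empty_Collect_eq insertCI
        mem_Collect_eq singleton_conv2 subset_singletonD subsetI singletonD)
    then show ?thesis by (auto simp: top_ereal_def)
  next
    case False
    have "0 \<le> c" if ae: "AE (y, w, w') in ?M. eta_cond \<mu> n p i j y w w' \<le> c" for c p
    proof (rule ccontr)
      assume "\<not> 0 \<le> c"
      have "AE v in ?M. False"
        using ae by eventually_elim (use \<open>\<not> 0 \<le> c\<close> order_trans[OF nn] in \<open>auto\<close>)
      then show False using False by (simp add: AE_iff_measurable[OF _ refl])
    qed
    then have "0 \<le> eta_bar_pos \<mu> n p i j" for p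
      unfolding eta_bar_pos_def by (intro Inf_greatest) auto
    then have "0 \<le> eta_bar \<mu> n m i j"
      unfolding eta_bar_def
      by (intro Inf_greatest) (auto intro: LIMSEQ_le_const)
    then show ?thesis by (rule real_of_ereal_pos)
  qed
qed

lemma linf_norm_Delta:
  assumes "2 \<le> n"
  shows "linf_norm n (Delta \<mu> n m) =
    Max ((\<lambda>i. 1 + (\<Sum>j=i+1..n. real_of_ereal (eta_bar \<mu> n m i j))) ` {1..<n})"
proof -
  let ?r = "\<lambda>i. 1 + (\<Sum>j=i+1..n. real_of_ereal (eta_bar \<mu> n m i j))"
  have row: "(\<Sum>j=1..n. \<bar>Delta \<mu> n m i j\<bar>) = ?r i" if "i \<in> {1..n}" for i
  proof -
    have "(\<Sum>j=1..n. \<bar>Delta \<mu> n m i j\<bar>) = (\<Sum>j\<in>{i..n}. \<bar>Delta \<mu> n m i j\<bar>)"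
      using that by (intro sum.mono_neutral_right) (auto simp: Delta_def)
    also have "\<dots> = \<bar>Delta \<mu> n m i i\<bar> + (\<Sum>j=i+1..n. \<bar>Delta \<mu> n m i j\<bar>)"
      using that by (simp add: sum.atLeast_Suc_atMost)
    also have "\<dots> = ?r i"
      by (intro arg_cong2[where f=plus] sum.cong) (simp_all add: Delta_def real_eta_bar_nonneg del: abs_real_of_ereal)
    finally show ?thesis .
  qed
  have ge: "1 \<le> ?r i" for i
    by (simp add: sum_nonneg real_eta_bar_nonneg)
  have "linf_norm n (Delta \<mu> n m) = Max (?r ` {1..n})"
    unfolding linf_norm_def using row by (intro arg_cong[where f=Max] image_cong) auto
  also have "{1..n} = insert n {1..<n}" using assms by auto
  also have "Max (?r ` insert n {1..<n}) = max (?r n) (Max (?r ` {1..<n}))"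
    using assms by simp
  also have "\<dots> = Max (?r ` {1..<n})"
  proof -
    have "?r 1 \<le> Max (?r ` {1..<n})" using assms by (intro Max_ge) auto
    then have "1 \<le> Max (?r ` {1..<n})" using ge[of 1] by linarith
    then show ?thesis by (simp add: max_def)
  qed
  finally show ?thesis .
qed

subsection \<open>Empirical measure and marginals\<close>

definition emp_measure :: "nat \<Rightarrow> (nat \<Rightarrow> 'a) \<Rightarrow> 'a set \<Rightarrow> real" where
  "emp_measure n x A = (1 / real n) * (\<Sum>i=1..n. indicator A (x i))"

definition marginal :: "'a measure \<Rightarrow> 'b measure \<Rightarrow> (nat \<Rightarrow> 'b \<Rightarrow> 'a) \<Rightarrow> nat \<Rightarrow> (nat \<Rightarrow> 'a) measure" where
  "marginal \<mu> P X n = distr P (pow_measure \<mu> n) (\<lambda>\<omega>. \<lambda>i\<in>{1..n}. X i \<omega>)"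

end

theory Submission
  imports Defs
begin

text \<open>
  The function \<open>S x = \<Sum>\<^sub>j 1\<^sub>A(x\<^sub>j)\<close> is additive, so its Doob martingale has the explicit form
  \<open>\<Sum>\<^sub>j P(X\<^sub>j \<in> A | X\<^bsub>1:i\<^esub>)\<close>, which is a quotient of integrals of the density of \<open>\<^bold>P\<^sub>n\<close>.
  Changing the coordinate \<open>i\<close> of the past leaves the terms \<open>j < i\<close> unchanged, moves the term
  \<open>j = i\<close> by at most \<open>1\<close> and a term \<open>j > i\<close> by at most the mixing coefficient \<open>\<eta>\<^bsub>ij\<^esub>\<close>, hence
  the martingale differences are bounded by a row sum of \<open>\<Delta>\<^sub>n\<close>, and Hoeffding's lemma applied to
  one coordinate at a time gives a sub-Gaussian bound.

  The coefficient \<open>\<eta>\<^bsub>ij\<^esub>\<close> is an infimum of limits along strictly positive densities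
  converging in total variation, possibly different ones for different \<open>(i, j)\<close>. Such densities
  converge in \<open>L\<^sup>1\<close>, so along a subsequence their conditional laws converge at almost every past of
  positive density, and the bound passes to the limit separately for each \<open>(i, j)\<close>. Mixing the
  density with a strictly positive one shows that the infimum is over a nonempty set; otherwise it
  would be \<open>\<infinity>\<close>, which \<open>real_of_ereal\<close> sends to \<open>0\<close>.

  The lower tail is the upper tail of the complement of \<open>A\<close>, and almost sure convergence is the
  Borel-Cantelli lemma.
\<close>

section \<open>Hoeffding's lemma on one coordinate, and quotients of extended reals\<close>

text \<open>Averaging the pairwise bound over \<open>y\<close> places \<open>S\<close> within
  \<open>c\<close> of its mean almost surely. Hoeffding's lemma on the interval from
  \<open>- c\<close> to \<open>c\<close> then gives the exponent
  \<open>l\<^sup>2 * (2 * c)\<^sup>2 / 8 = l\<^sup>2 * c\<^sup>2 / 2\<close>, the source of the 2 in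
  the final bound.\<close>

lemma (in prob_space) nn_integral_exp_le_of_pairwise_close:
  fixes S :: "'a \<Rightarrow> real"
  assumes [measurable]: "S \<in> borel_measurable M" and bdd: "\<And>x. x \<in> space M \<Longrightarrow> \<bar>S x\<bar> \<le> C"
    and close: "AE x in M. AE y in M. \<bar>S x - S y\<bar> \<le> c" and l: "0 < l"
  shows "(\<integral>\<^sup>+x. ennreal (exp (l * S x)) \<partial>M) \<le> ennreal (exp (l\<^sup>2 * c\<^sup>2 / 2 + l * expectation S))"
proof -
  have int: "integrable M S"
    using bdd by (intro integrable_const_bound[where B = C]) auto
  have "AE x in M. \<bar>S x - expectation S\<bar> \<le> c"
    using close AE_space
  proof eventually_elim
    case (elim x)
    have "\<bar>S x - expectation S\<bar> = \<bar>expectation (\<lambda>y. S x - S y)\<bar>"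
      using int by (simp add: prob_space)
    also have "\<dots> \<le> expectation (\<lambda>y. \<bar>S x - S y\<bar>)"
      by (rule integral_abs_bound)
    also have "\<dots> \<le> expectation (\<lambda>y. c)"
      using elim int by (intro integral_mono_AE) auto
    finally show ?case by (simp add: prob_space)
  qed
  then interpret interval_bounded_random_variable M "\<lambda>x. S x - expectation S" "- c" c
    by unfold_locales auto
  have "(\<integral>\<^sup>+x. ennreal (exp (l * S x)) \<partial>M)
      = (\<integral>\<^sup>+x. ennreal (exp (l * expectation S)) * ennreal (exp (l * (S x - expectation S))) \<partial>M)"
    by (intro nn_integral_cong) (simp add: exp_add[symmetric] ennreal_mult[symmetric] algebra_simps)
  also have "\<dots> = ennreal (exp (l * expectation S)) * (\<integral>\<^sup>+x. ennreal (exp (l * (S x - expectation S))) \<partial>M)"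
    by (rule nn_integral_cmult) simp
  also have "\<dots> \<le> ennreal (exp (l * expectation S)) * ennreal (exp (l\<^sup>2 * (c - - c)\<^sup>2 / 8))"
    using int l by (intro mult_left_mono Hoeffdings_lemma_nn_integral_0) (auto simp: prob_space)
  also have "\<dots> = ennreal (exp (l\<^sup>2 * c\<^sup>2 / 2 + l * expectation S))"
    by (simp add: exp_add[symmetric] ennreal_mult[symmetric] power2_eq_square field_simps)
  finally show ?thesis .
qed

lemma ratio_le_1: "0 \<le> a \<Longrightarrow> a \<le> b \<Longrightarrow> a / b \<le> (1::real)"
  by (cases "b = 0") (auto simp: field_simps)

text \<open>Cancels the normaliser \<open>b\<close> when a conditional probability
  \<open>a / b\<close> is integrated against the density \<open>b / c\<close>. If
  \<open>b = 0\<close>, then \<open>a = 0\<close> and both sides are 0.\<close>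

lemma ennreal_ratio_mult:
  assumes "a \<le> b" "b \<noteq> \<infinity>" "c \<noteq> 0" "c \<noteq> \<infinity>"
  shows "b / c * ennreal (enn2real a / enn2real b) = a / c"
proof -
  have "a \<noteq> \<infinity>" using assms by (auto simp: top_unique)
  then show ?thesis
    using assms
    by (cases a; cases b; cases c) (auto simp: divide_ennreal ennreal_mult[symmetric] less_le)
qed

lemma ennreal_mult_divide_cancel: "c \<noteq> 0 \<Longrightarrow> c \<noteq> \<infinity> \<Longrightarrow> c * (a / c) = (a :: ennreal)"
  by (cases a; cases c) (auto simp: divide_ennreal less_le ennreal_top_divide ennreal_mult[symmetric] ennreal_mult_top)

lemma enn2real_divide_pos:
  assumes "c \<noteq> 0" "c \<noteq> \<infinity>"
  shows "enn2real (a / c) = enn2real a / enn2real c"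
  using assms by (cases a; cases c) (auto simp: divide_ennreal less_le ennreal_top_divide)

subsection \<open>Total variation norm\<close>

text \<open>Lower bounds on the norm come from a choice of the two sets: a set and its complement, a
  Hahn set and its complement, or the whole space and the empty set.\<close>

lemma half_diff_le_tv_norm:
  assumes "A \<in> sets M" "B \<in> sets M"
  shows "ereal ((\<tau> A - \<tau> B) / 2) \<le> tv_norm M \<tau>"
proof -
  have "ereal (\<tau> A) - ereal (\<tau> B) \<le> (SUP A\<in>sets M. ereal (\<tau> A)) - (INF A\<in>sets M. ereal (\<tau> A))"
    using assms by (intro ereal_minus_mono SUP_upper INF_lower)
  then have "(ereal (\<tau> A) - ereal (\<tau> B)) / 2 \<le> tv_norm M \<tau>"
    unfolding tv_norm_def by (rule ereal_divide_right_mono) simp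
  then show ?thesis by simp
qed

text \<open>For a difference of two measures of equal total mass, the complement flips the sign, so
  the pair \<open>B\<close>, \<open>space M - B\<close> produces all of
  \<open>\<bar>\<tau> B\<bar>\<close> and not just half of it.\<close>

lemma abs_le_tv_norm:
  assumes B: "B \<in> sets M" and compl: "\<tau> (space M - B) = - \<tau> B"
  shows "ereal \<bar>\<tau> B\<bar> \<le> tv_norm M \<tau>"
  using half_diff_le_tv_norm[of B M "space M - B" \<tau>] half_diff_le_tv_norm[of "space M - B" M B \<tau>] B
  by (cases "0 \<le> \<tau> B") (auto simp: compl)

lemma tv_norm_le:
  assumes "\<And>A. A \<in> sets M \<Longrightarrow> \<bar>\<tau> A\<bar> \<le> c"
  shows "tv_norm M \<tau> \<le> ereal c"
proof -
  have "(SUP A\<in>sets M. ereal (\<tau> A)) \<le> ereal c"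
    using assms by (intro SUP_least) (auto simp: abs_le_iff)
  moreover have "ereal (- c) \<le> (INF A\<in>sets M. ereal (\<tau> A))"
    using assms by (intro INF_greatest) (fastforce simp: abs_le_iff)
  ultimately have "tv_norm M \<tau> \<le> (ereal c - ereal (- c)) / 2"
    unfolding tv_norm_def by (intro ereal_divide_right_mono ereal_minus_mono) simp_all
  then show ?thesis by simp
qed

text \<open>Both sides are \<open>enn2real\<close> of the same nonnegative integral; if that is
  infinite, \<open>measure\<close> and the Bochner integral both default to 0.\<close>

lemma measure_density_real:
  fixes f :: "'a \<Rightarrow> real"
  assumes "f \<in> borel_measurable M" "\<And>x. x \<in> space M \<Longrightarrow> 0 \<le> f x" "B \<in> sets M"
  shows "measure (density M (\<lambda>x. ennreal (f x))) B = (\<integral>x. f x * indicator B x \<partial>M)"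
proof -
  have "emeasure (density M (\<lambda>x. ennreal (f x))) B = (\<integral>\<^sup>+x. ennreal (f x * indicator B x) \<partial>M)"
    using assms by (subst emeasure_density) (auto intro!: nn_integral_cong split: split_indicator)
  moreover have "(\<integral>x. f x * indicator B x \<partial>M) = enn2real (\<integral>\<^sup>+x. ennreal (f x * indicator B x) \<partial>M)"
    using assms by (intro integral_eq_nn_integral) auto
  ultimately show ?thesis by (simp add: measure_def)
qed

text \<open>The set where \<open>p < q\<close> is a Hahn set of the signed measure with density
  \<open>q - p\<close>: its value minus the value of its complement is the L1 distance.\<close>

lemma L1_dist_le_tv_norm:
  fixes p q :: "'a \<Rightarrow> real"
  assumes p: "integrable M p" "\<And>x. x \<in> space M \<Longrightarrow> 0 \<le> p x"
    and q: "integrable M q" "\<And>x. x \<in> space M \<Longrightarrow> 0 \<le> q x"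
  shows "ereal ((\<integral>x. \<bar>q x - p x\<bar> \<partial>M) / 2) \<le>
    tv_norm M (\<lambda>A. measure (density M (\<lambda>x. ennreal (q x))) A - measure (density M (\<lambda>x. ennreal (p x))) A)"
proof -
  note [measurable] = borel_measurable_integrable[OF p(1)] borel_measurable_integrable[OF q(1)]
  let ?B = "{x \<in> space M. p x < q x}"
  let ?\<tau> = "\<lambda>A. measure (density M (\<lambda>x. ennreal (q x))) A - measure (density M (\<lambda>x. ennreal (p x))) A"
  have B: "?B \<in> sets M" "space M - ?B \<in> sets M" by measurable
  have \<tau>: "?\<tau> C = (\<integral>x. (q x - p x) * indicator C x \<partial>M)" and int: "integrable M (\<lambda>x. (q x - p x) * indicator C x)"
    if C: "C \<in> sets M" for C
  proof -
    have i: "integrable M (\<lambda>x. q x * indicator C x)" "integrable M (\<lambda>x. p x * indicator C x)"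
      using p q C by (auto intro!: integrable_real_mult_indicator)
    show "?\<tau> C = (\<integral>x. (q x - p x) * indicator C x \<partial>M)"
      using p q C i by (simp add: measure_density_real left_diff_distrib)
    show "integrable M (\<lambda>x. (q x - p x) * indicator C x)"
      using i by (simp add: left_diff_distrib)
  qed
  have "?\<tau> ?B - ?\<tau> (space M - ?B)
    = (\<integral>x. (q x - p x) * indicator ?B x - (q x - p x) * indicator (space M - ?B) x \<partial>M)"
    using int[OF B(1)] int[OF B(2)] by (simp add: \<tau>[OF B(1)] \<tau>[OF B(2)])
  also have "\<dots> = (\<integral>x. \<bar>q x - p x\<bar> \<partial>M)"
    by (intro Bochner_Integration.integral_cong) (auto split: split_indicator)
  finally show ?thesis
    using half_diff_le_tv_norm[OF B, of ?\<tau>] by simp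
qed

subsection \<open>Conditional probabilities from a density\<close>

text \<open>For a density \<open>f\<close> of the whole vector this is the marginal density of the
  first \<open>i\<close> coordinates. With extended-real values Tonelli's theorem applies to every
  measurable \<open>f\<close>, and degenerate pasts show up as the values 0 and \<infinity>.\<close>

definition tail_integral ::
  "'a measure \<Rightarrow> nat \<Rightarrow> nat \<Rightarrow> ((nat \<Rightarrow> 'a) \<Rightarrow> ennreal) \<Rightarrow> (nat \<Rightarrow> 'a) \<Rightarrow> ennreal" where
  "tail_integral \<mu> n i f x = (\<integral>\<^sup>+u. f (merge {1..i} {i<..n} (x, u)) \<partial>PiM {i<..n} (\<lambda>_. \<mu>))"

text \<open>The conditional probability of \<open>X\<^sub>j \<in> A\<close> given \<open>X\<^bsub>1:i\<^esub> = x\<close>; it is \<open>0\<close> where the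
  density of \<open>X\<^bsub>1:i\<^esub>\<close> is \<open>0\<close> or \<open>\<infinity>\<close>.\<close>

definition tail_prob ::
  "'a measure \<Rightarrow> nat \<Rightarrow> ((nat \<Rightarrow> 'a) \<Rightarrow> ennreal) \<Rightarrow> nat \<Rightarrow> nat \<Rightarrow> 'a set \<Rightarrow> (nat \<Rightarrow> 'a) \<Rightarrow> real" where
  "tail_prob \<mu> n p i j A x =
     enn2real (tail_integral \<mu> n i (\<lambda>z. p z * indicator A (z j)) x) / enn2real (tail_integral \<mu> n i p x)"

lemma Suc_interval_insert: "{1..Suc k} = insert (Suc k) {1..k}"
  by auto

lemma interval_split_Un: "i \<le> n \<Longrightarrow> {1..i} \<union> {i<..n} = {1..n::nat}"
  by auto

lemma merge_fun_upd_Suc: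
  assumes "Suc k \<le> n"
  shows "merge {1..k} {k<..n} (y, u(Suc k := w)) = merge {1..Suc k} {Suc k<..n} (y(Suc k := w), u)"
proof (rule ext)
  fix i
  have "i \<le> k \<or> i = Suc k \<or> Suc k < i" by linarith
  then show "merge {1..k} {k<..n} (y, u(Suc k := w)) i = merge {1..Suc k} {Suc k<..n} (y(Suc k := w), u) i"
    using assms by (elim disjE) (simp_all add: merge_def)
qed

context
  fixes \<mu> :: "'a measure"
  assumes sigma_finite_mu: "sigma_finite_measure \<mu>"
  notes [simp del] = One_nat_def
begin

interpretation product_sigma_finite "\<lambda>_::nat. \<mu>"
  by (simp add: product_sigma_finite_def sigma_finite_mu)

lemma sigma_finite_pow: "finite I \<Longrightarrow> sigma_finite_measure (PiM I (\<lambda>_::nat. \<mu>))"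
  by (rule sigma_finite)

lemma measurable_merge_split:
  assumes "i \<le> n"
  shows "merge {1..i} {i<..n} \<in> measurable (pow_measure \<mu> i \<Otimes>\<^sub>M PiM {i<..n} (\<lambda>_. \<mu>)) (pow_measure \<mu> n)"
  using measurable_merge[of "{1..i}" "{i<..n}" "\<lambda>_. \<mu>"] unfolding interval_split_Un[OF assms] .

lemma measurable_merge_section:
  assumes "i \<le> n" "x \<in> space (pow_measure \<mu> i)"
  shows "(\<lambda>u. merge {1..i} {i<..n} (x, u)) \<in> measurable (PiM {i<..n} (\<lambda>_. \<mu>)) (pow_measure \<mu> n)"
  using measurable_compose[OF measurable_Pair1'[OF assms(2)] measurable_merge_split[OF assms(1)]] .

lemma measurable_tail_integral:
  assumes "i \<le> n" "f \<in> borel_measurable (pow_measure \<mu> n)"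
  shows "tail_integral \<mu> n i f \<in> borel_measurable (pow_measure \<mu> i)"
proof -
  interpret J: sigma_finite_measure "PiM {i<..n} (\<lambda>_. \<mu>)" by (rule sigma_finite_pow) simp
  show ?thesis
    unfolding tail_integral_def
    using measurable_compose[OF measurable_merge_split[OF assms(1)] assms(2)]
    by (intro J.borel_measurable_nn_integral) (simp add: case_prod_beta')
qed

lemma nn_integral_tail_integral:
  assumes "i \<le> n" "f \<in> borel_measurable (pow_measure \<mu> n)"
  shows "(\<integral>\<^sup>+x. tail_integral \<mu> n i f x \<partial>pow_measure \<mu> i) = (\<integral>\<^sup>+x. f x \<partial>pow_measure \<mu> n)"
  unfolding tail_integral_def
  by (rule product_nn_integral_fold[of "{1..i}" "{i<..n}" f, unfolded interval_split_Un[OF assms(1)], symmetric])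
    (use assms in auto)

text \<open>Tonelli's theorem splits the coordinate \<open>Suc k\<close> off the future. This is the
  unnormalised tower property behind the martingale identity.\<close>

lemma tail_integral_Suc:
  assumes "Suc k \<le> n" "f \<in> borel_measurable (pow_measure \<mu> n)" "y \<in> space (pow_measure \<mu> k)"
  shows "tail_integral \<mu> n k f y = (\<integral>\<^sup>+w. tail_integral \<mu> n (Suc k) f (y(Suc k := w)) \<partial>\<mu>)"
proof -
  have eq: "{k<..n} = insert (Suc k) {Suc k<..n}" using assms by auto
  have "(\<lambda>u. f (merge {1..k} {k<..n} (y, u))) \<in> borel_measurable (PiM {k<..n} (\<lambda>_. \<mu>))"
    by (rule measurable_compose[OF measurable_merge_section[OF Suc_leD[OF assms(1)] assms(3)] assms(2)])
  then have "tail_integral \<mu> n k f y =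
    (\<integral>\<^sup>+w. (\<integral>\<^sup>+u. f (merge {1..k} {k<..n} (y, u(Suc k := w))) \<partial>PiM {Suc k<..n} (\<lambda>_. \<mu>)) \<partial>\<mu>)"
    unfolding tail_integral_def
    by (intro product_nn_integral_insert_rev[of "{Suc k<..n}" "Suc k" "\<lambda>u. f (merge {1..k} {k<..n} (y, u))", folded eq])
      (simp_all only: finite_greaterThanAtMost greaterThanAtMost_iff less_irrefl simp_thms)
  also have "\<dots> = (\<integral>\<^sup>+w. tail_integral \<mu> n (Suc k) f (y(Suc k := w)) \<partial>\<mu>)"
    by (simp only: tail_integral_def merge_fun_upd_Suc[OF assms(1)])
  finally show ?thesis .
qed

text \<open>No future is left: the product over the empty index set is a point mass, and merging
  with its only point changes nothing.\<close>

lemma tail_integral_all: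
  assumes "x \<in> space (pow_measure \<mu> n)"
  shows "tail_integral \<mu> n n f x = f x"
proof -
  have "merge {1..n} {} (x, \<lambda>_. undefined) = x"
    using assms by (auto simp: merge_def fun_eq_iff space_PiM PiE_def extensional_def)
  then show ?thesis by (simp add: tail_integral_def nn_integral_empty)
qed

lemma tail_integral_0: "tail_integral \<mu> n 0 f x = (\<integral>\<^sup>+z. f z \<partial>pow_measure \<mu> n)"
proof -
  have "{0<..n} = {1..n}" by auto
  moreover have "merge {} {1..n} (x, u) = u" if "u \<in> space (pow_measure \<mu> n)" for u
    using that by (auto simp: merge_def fun_eq_iff space_PiM PiE_def extensional_def)
  ultimately show ?thesis
    unfolding tail_integral_def by (auto intro!: nn_integral_cong)
qed

lemma tail_integral_mono:
  "(\<And>z. f z \<le> g z) \<Longrightarrow> tail_integral \<mu> n i f x \<le> tail_integral \<mu> n i g x"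
  unfolding tail_integral_def by (intro nn_integral_mono) auto

lemma tail_integral_indicator_past:
  assumes "i \<le> n" "f \<in> borel_measurable (pow_measure \<mu> n)" "x \<in> space (pow_measure \<mu> i)" "j \<in> {1..i}"
  shows "tail_integral \<mu> n i (\<lambda>z. f z * indicator A (z j)) x = tail_integral \<mu> n i f x * indicator A (x j)"
proof -
  have "tail_integral \<mu> n i (\<lambda>z. f z * indicator A (z j)) x
    = (\<integral>\<^sup>+u. f (merge {1..i} {i<..n} (x, u)) * indicator A (x j) \<partial>PiM {i<..n} (\<lambda>_. \<mu>))"
    unfolding tail_integral_def using assms(4) by (intro nn_integral_cong) (auto simp: merge_def)
  also have "\<dots> = tail_integral \<mu> n i f x * indicator A (x j)"
    unfolding tail_integral_def
    using measurable_compose[OF measurable_merge_section assms(2)] assms(1,3)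
    by (intro nn_integral_multc) auto
  finally show ?thesis .
qed

lemma measurable_mult_indicator_component:
  assumes "f \<in> borel_measurable (pow_measure \<mu> n)" "A \<in> sets \<mu>" "j \<in> {1..n}"
  shows "(\<lambda>z. f z * indicator A (z j) :: ennreal) \<in> borel_measurable (pow_measure \<mu> n)"
  using assms by measurable

lemma measurable_tail_prob:
  assumes "i \<le> n" "p \<in> borel_measurable (pow_measure \<mu> n)" "A \<in> sets \<mu>" "j \<in> {1..n}"
  shows "tail_prob \<mu> n p i j A \<in> borel_measurable (pow_measure \<mu> i)"
proof -
  note [measurable] = measurable_tail_integral[OF assms(1,2)]
    measurable_tail_integral[OF assms(1) measurable_mult_indicator_component[OF assms(2,3,4)]]
  show ?thesis unfolding tail_prob_def by measurable
qed

lemma tail_integral_indicator_le: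
  "tail_integral \<mu> n i (\<lambda>z. p z * indicator A (z j)) x \<le> tail_integral \<mu> n i p x"
  by (intro tail_integral_mono) (auto split: split_indicator)

lemma tail_prob_nonneg: "0 \<le> tail_prob \<mu> n p i j A x"
  by (simp add: tail_prob_def)

lemma tail_prob_le_1: "tail_prob \<mu> n p i j A x \<le> 1"
\<comment> \<open>An infinite denominator becomes 0 under \<open>enn2real\<close>, and the quotient
  is then 0.\<close>
proof (cases "tail_integral \<mu> n i p x = \<infinity>")
  case False
  then have "tail_integral \<mu> n i p x < top" by (simp add: less_top)
  then have "enn2real (tail_integral \<mu> n i (\<lambda>z. p z * indicator A (z j)) x) \<le> enn2real (tail_integral \<mu> n i p x)"
    by (rule enn2real_mono[OF tail_integral_indicator_le])
  then show ?thesis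
    unfolding tail_prob_def by (rule ratio_le_1[OF enn2real_nonneg])
qed (simp add: tail_prob_def)

lemma tail_prob_past:
  assumes "i \<le> n" "p \<in> borel_measurable (pow_measure \<mu> n)" "x \<in> space (pow_measure \<mu> i)" "j \<in> {1..i}"
    and "tail_integral \<mu> n i p x \<noteq> 0" "tail_integral \<mu> n i p x \<noteq> \<infinity>"
  shows "tail_prob \<mu> n p i j A x = indicator A (x j)"
  using assms(5,6) tail_integral_indicator_past[OF assms(1-4), of A]
  by (auto simp: tail_prob_def enn2real_eq_0_iff split: split_indicator)

text \<open>\<open>\<kappa>\<close> is the law of the coordinate \<open>k + 1\<close> given \<open>X\<^bsub>1:k\<^esub> = y\<close>; the second
  claim is the martingale property of the conditional probabilities.\<close>

lemma next_coordinate_law: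
  fixes p :: "(nat \<Rightarrow> 'a) \<Rightarrow> ennreal" and n k :: nat and y :: "nat \<Rightarrow> 'a"
  assumes k: "Suc k \<le> n" and p: "p \<in> borel_measurable (pow_measure \<mu> n)"
    and y: "y \<in> space (pow_measure \<mu> k)"
    and D: "tail_integral \<mu> n k p y \<noteq> 0" "tail_integral \<mu> n k p y \<noteq> \<infinity>"
  defines "\<kappa> \<equiv> density \<mu> (\<lambda>w. tail_integral \<mu> n (Suc k) p (y(Suc k := w)) / tail_integral \<mu> n k p y)"
  shows prob_space_next_coordinate: "prob_space \<kappa>"
    and expectation_tail_prob_Suc: "A \<in> sets \<mu> \<Longrightarrow> j \<in> {1..n} \<Longrightarrow>
      (\<integral>w. tail_prob \<mu> n p (Suc k) j A (y(Suc k := w)) \<partial>\<kappa>) = tail_prob \<mu> n p k j A y"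
proof -
  let ?d = "\<lambda>w. tail_integral \<mu> n (Suc k) p (y(Suc k := w))" and ?D = "tail_integral \<mu> n k p y"
  have upd: "(\<lambda>w. y(Suc k := w)) \<in> measurable \<mu> (pow_measure \<mu> (Suc k))"
    using y by (intro measurable_fun_upd[where J = "{1..k}"]) auto
  have T: "(\<lambda>w. tail_integral \<mu> n (Suc k) f (y(Suc k := w))) \<in> borel_measurable \<mu>"
    if "f \<in> borel_measurable (pow_measure \<mu> n)" for f
    by (rule measurable_compose[OF upd measurable_tail_integral[OF k that]])
  note [measurable] = T[OF p]
  have DD: "?D = (\<integral>\<^sup>+w. ?d w \<partial>\<mu>)" by (rule tail_integral_Suc[OF k p y])
  have D': "?D * inverse ?D = 1" "?D / ?D = 1"
    using D by (auto simp: ennreal_divide_self ennreal_mult_divide_eq divide_ennreal_def[symmetric] less_top zero_less_iff_neq_zero)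
  show "prob_space \<kappa>"
    unfolding \<kappa>_def
    by (rule prob_spaceI) (simp add: emeasure_density nn_integral_divide DD[symmetric] D')
  assume A: "A \<in> sets \<mu>" and j: "j \<in> {1..n}"
  let ?f = "\<lambda>z. p z * indicator A (z j) :: ennreal"
  let ?N = "\<lambda>w. tail_integral \<mu> n (Suc k) ?f (y(Suc k := w))"
  have f: "?f \<in> borel_measurable (pow_measure \<mu> n)" using A j p by measurable
  note [measurable] = T[OF f] measurable_compose[OF upd measurable_tail_prob[OF k p A j]]
  \<comment> \<open>The integral of \<open>?d\<close> is the finite \<open>?D\<close>. Infinite
    values must be excluded because \<open>tail_prob\<close> reads an infinite denominator as 0, so
    nothing would cancel.\<close>
  have fin: "AE w in \<mu>. ?d w \<noteq> \<infinity>"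
    using D(2) DD by (intro nn_integral_noteq_infinite) auto
  have "(\<integral>w. tail_prob \<mu> n p (Suc k) j A (y(Suc k := w)) \<partial>\<kappa>)
    = enn2real (\<integral>\<^sup>+w. ennreal (tail_prob \<mu> n p (Suc k) j A (y(Suc k := w))) \<partial>\<kappa>)"
    by (intro integral_eq_nn_integral) (auto simp: \<kappa>_def tail_prob_nonneg)
  also have "(\<integral>\<^sup>+w. ennreal (tail_prob \<mu> n p (Suc k) j A (y(Suc k := w))) \<partial>\<kappa>)
    = (\<integral>\<^sup>+w. ?d w / ?D * ennreal (tail_prob \<mu> n p (Suc k) j A (y(Suc k := w))) \<partial>\<mu>)"
    unfolding \<kappa>_def by (intro nn_integral_density) auto
  also have "\<dots> = (\<integral>\<^sup>+w. ?N w / ?D \<partial>\<mu>)"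
  proof (intro nn_integral_cong_AE)
    show "AE w in \<mu>. ?d w / ?D * ennreal (tail_prob \<mu> n p (Suc k) j A (y(Suc k := w))) = ?N w / ?D"
      using fin
    proof eventually_elim
      case (elim w)
      then show ?case
        unfolding tail_prob_def by (intro ennreal_ratio_mult tail_integral_indicator_le D)
    qed
  qed
  also have "\<dots> = tail_integral \<mu> n k ?f y / ?D"
    by (simp add: nn_integral_divide tail_integral_Suc[OF k f y])
  also have "enn2real \<dots> = tail_prob \<mu> n p k j A y"
    using D by (simp add: tail_prob_def enn2real_divide_pos)
  finally show "(\<integral>w. tail_prob \<mu> n p (Suc k) j A (y(Suc k := w)) \<partial>\<kappa>) = tail_prob \<mu> n p k j A y" .
qed

lemma nn_integral_pow_Suc:
  assumes "f \<in> borel_measurable (pow_measure \<mu> (Suc k))"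
  shows "(\<integral>\<^sup>+x. f x \<partial>pow_measure \<mu> (Suc k)) = (\<integral>\<^sup>+y. (\<integral>\<^sup>+w. f (y(Suc k := w)) \<partial>\<mu>) \<partial>pow_measure \<mu> k)"
  using product_nn_integral_insert[of "{1..k}" "Suc k" f] assms
  by (simp add: Suc_interval_insert)

lemma measurable_upd_Suc:
  "y \<in> space (pow_measure \<mu> k) \<Longrightarrow> (\<lambda>w. y(Suc k := w)) \<in> measurable \<mu> (pow_measure \<mu> (Suc k))"
  by (intro measurable_fun_upd[where J = "{1..k}"]) auto

subsection \<open>Exponential moments\<close>

text \<open>Given the past \<open>y\<close>, the next coordinate has law \<open>\<kappa>\<close>,
  under which the sum of conditional probabilities at time \<open>Suc k\<close> has the sum at time
  \<open>k\<close> as its mean, so Hoeffding's lemma applies. Keeping the marginal densities as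
  weights lets the steps be chained by Tonelli's theorem.\<close>

lemma exp_moment_step:
  fixes p :: "(nat \<Rightarrow> 'a) \<Rightarrow> ennreal" and n k :: nat and y :: "nat \<Rightarrow> 'a"
  assumes k: "Suc k \<le> n" and p: "p \<in> borel_measurable (pow_measure \<mu> n)"
    and y: "y \<in> space (pow_measure \<mu> k)" and A: "A \<in> sets \<mu>" and l: "0 < l"
    and Dfin: "tail_integral \<mu> n k p y \<noteq> \<infinity>"
    and close: "AE w in \<mu>. AE w' in \<mu>.
      tail_integral \<mu> n (Suc k) p (y(Suc k := w)) \<notin> {0, \<infinity>} \<longrightarrow>
      tail_integral \<mu> n (Suc k) p (y(Suc k := w')) \<notin> {0, \<infinity>} \<longrightarrow>
      \<bar>(\<Sum>j=1..n. tail_prob \<mu> n p (Suc k) j A (y(Suc k := w)))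
        - (\<Sum>j=1..n. tail_prob \<mu> n p (Suc k) j A (y(Suc k := w')))\<bar> \<le> c"
  shows "(\<integral>\<^sup>+w. ennreal (exp (l * (\<Sum>j=1..n. tail_prob \<mu> n p (Suc k) j A (y(Suc k := w)))))
            * tail_integral \<mu> n (Suc k) p (y(Suc k := w)) \<partial>\<mu>)
    \<le> ennreal (exp (l\<^sup>2 * c\<^sup>2 / 2)) *
      (ennreal (exp (l * (\<Sum>j=1..n. tail_prob \<mu> n p k j A y))) * tail_integral \<mu> n k p y)"
proof -
  let ?d = "\<lambda>w. tail_integral \<mu> n (Suc k) p (y(Suc k := w))" and ?D = "tail_integral \<mu> n k p y"
  let ?t = "\<lambda>j w. tail_prob \<mu> n p (Suc k) j A (y(Suc k := w))"
  let ?S = "\<lambda>w. \<Sum>j=1..n. ?t j w"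
  let ?s = "\<Sum>j=1..n. tail_prob \<mu> n p k j A y"
  have [measurable]: "?d \<in> borel_measurable \<mu>"
    by (rule measurable_compose[OF measurable_upd_Suc[OF y] measurable_tail_integral[OF k p]])
  have t[measurable]: "?t j \<in> borel_measurable \<mu>" if "j \<in> {1..n}" for j
    by (rule measurable_compose[OF measurable_upd_Suc[OF y] measurable_tail_prob[OF k p A that]])
  have S[measurable]: "?S \<in> borel_measurable \<mu>"
    by (intro borel_measurable_sum t)
  have DD: "?D = (\<integral>\<^sup>+w. ?d w \<partial>\<mu>)" by (rule tail_integral_Suc[OF k p y])
  show ?thesis
  proof (cases "?D = 0")
    \<comment> \<open>Almost every extension of a past of density 0 has density 0, so both sides
      vanish.\<close>
    case True
    then have "AE w in \<mu>. ?d w = 0"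
      using DD by (simp add: nn_integral_0_iff_AE)
    then have "(\<integral>\<^sup>+w. ennreal (exp (l * ?S w)) * ?d w \<partial>\<mu>) = (\<integral>\<^sup>+w. 0 \<partial>\<mu>)"
      by (intro nn_integral_cong_AE) auto
    then show ?thesis by simp
  next
    case False
    define \<kappa> where "\<kappa> = density \<mu> (\<lambda>w. ?d w / ?D)"
    interpret \<kappa>: prob_space \<kappa>
      unfolding \<kappa>_def by (rule prob_space_next_coordinate[OF k p y False Dfin])
    have [measurable_cong]: "sets \<kappa> = sets \<mu>" and space_\<kappa>: "space \<kappa> = space \<mu>"
      by (simp_all add: \<kappa>_def)
    have pos: "0 < ?d w / ?D \<Longrightarrow> ?d w \<noteq> 0" for w
      by auto
    have fin: "AE w in \<mu>. ?d w \<noteq> \<infinity>"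
      using Dfin DD by (intro nn_integral_noteq_infinite) auto
    have AE\<kappa>: "(AE w in \<kappa>. Q w) \<longleftrightarrow> (AE w in \<mu>. 0 < ?d w / ?D \<longrightarrow> Q w)" for Q
      unfolding \<kappa>_def by (rule AE_density) measurable
    \<comment> \<open>The hypothesis \<open>close\<close> speaks only of extensions whose density is
      neither 0 nor \<infinity>. The law \<open>\<kappa>\<close> charges only these:
      \<open>AE\<kappa>\<close> removes the zeros and \<open>fin\<close> the infinite
      values.\<close>
    have closek: "AE w in \<kappa>. AE w' in \<kappa>. \<bar>?S w - ?S w'\<bar> \<le> c"
      unfolding AE\<kappa> using close fin
    proof eventually_elim
      case (elim w)
      have "AE w' in \<mu>. 0 < ?d w' / ?D \<longrightarrow> \<bar>?S w - ?S w'\<bar> \<le> c" if "0 < ?d w / ?D"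
        using elim(1) fin
      proof eventually_elim
        case (elim w')
        then show ?case using pos[OF that] pos[of w'] \<open>?d w \<noteq> \<infinity>\<close> by blast
      qed
      then show ?case by blast
    qed
    have bdd: "\<bar>?S w\<bar> \<le> real n" for w
    proof -
      have "?S w \<le> (\<Sum>j=1..n. 1)" by (intro sum_mono tail_prob_le_1)
      moreover have "0 \<le> ?S w" by (intro sum_nonneg tail_prob_nonneg)
      ultimately show ?thesis by simp
    qed
    have ES: "\<kappa>.expectation ?S = ?s"
    proof -
      have "integrable \<kappa> (?t j)" if "j \<in> {1..n}" for j
        using t[OF that] tail_prob_nonneg tail_prob_le_1
        by (intro \<kappa>.integrable_const_bound[where B = 1])
          (auto intro!: AE_I2 simp: measurable_cong_sets[OF \<open>sets \<kappa> = sets \<mu>\<close>])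
      then have "\<kappa>.expectation ?S = (\<Sum>j=1..n. \<kappa>.expectation (?t j))"
        by (rule Bochner_Integration.integral_sum)
      also have "\<dots> = ?s"
        unfolding \<kappa>_def by (intro sum.cong refl expectation_tail_prob_Suc[OF k p y False Dfin A])
      finally show ?thesis .
    qed
    have "(\<integral>\<^sup>+w. ennreal (exp (l * ?S w)) * ?d w \<partial>\<mu>)
      = (\<integral>\<^sup>+w. ?D * (?d w / ?D * ennreal (exp (l * ?S w))) \<partial>\<mu>)"
    proof (intro nn_integral_cong)
      fix w
      have "?D * (?d w / ?D) = ?d w"
        by (rule ennreal_mult_divide_cancel[OF False Dfin])
      then show "ennreal (exp (l * ?S w)) * ?d w = ?D * (?d w / ?D * ennreal (exp (l * ?S w)))"
        by (simp only: mult.assoc[symmetric] mult.commute[of "ennreal _"])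
    qed
    also have "\<dots> = ?D * (\<integral>\<^sup>+w. ?d w / ?D * ennreal (exp (l * ?S w)) \<partial>\<mu>)"
      by (intro nn_integral_cmult) measurable
    also have "(\<integral>\<^sup>+w. ?d w / ?D * ennreal (exp (l * ?S w)) \<partial>\<mu>) = (\<integral>\<^sup>+w. ennreal (exp (l * ?S w)) \<partial>\<kappa>)"
      unfolding \<kappa>_def by (intro nn_integral_density[symmetric]) measurable
    also have "?D * \<dots> \<le> ?D * ennreal (exp (l\<^sup>2 * c\<^sup>2 / 2 + l * \<kappa>.expectation ?S))"
      using S by (intro mult_left_mono \<kappa>.nn_integral_exp_le_of_pairwise_close[OF _ bdd closek l])
         (auto simp: measurable_cong_sets[OF \<open>sets \<kappa> = sets \<mu>\<close>])
    also have "\<dots> = ennreal (exp (l\<^sup>2 * c\<^sup>2 / 2)) * (ennreal (exp (l * ?s)) * ?D)"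
      by (simp add: ES exp_add ennreal_mult mult_ac)
    finally show ?thesis .
  qed
qed

text \<open>Induction on the number of revealed coordinates, each of which contributes one factor
  \<open>exp (l\<^sup>2 * c\<^sup>2 / 2)\<close>. At \<open>k = 0\<close> the only point of the
  empty product is \<open>\<lambda>_. undefined\<close>, where the sum is the unconditional
  mean.\<close>

lemma exp_moment_bound:
  fixes p :: "(nat \<Rightarrow> 'a) \<Rightarrow> ennreal" and n k :: nat
  assumes p: "p \<in> borel_measurable (pow_measure \<mu> n)" and int_p: "(\<integral>\<^sup>+x. p x \<partial>pow_measure \<mu> n) = 1"
    and A: "A \<in> sets \<mu>" and l: "0 < l"
    and close: "\<And>k. k < n \<Longrightarrow> AE (y, w, w') in pow_measure \<mu> k \<Otimes>\<^sub>M (\<mu> \<Otimes>\<^sub>M \<mu>).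
      tail_integral \<mu> n (Suc k) p (y(Suc k := w)) \<notin> {0, \<infinity>} \<longrightarrow>
      tail_integral \<mu> n (Suc k) p (y(Suc k := w')) \<notin> {0, \<infinity>} \<longrightarrow>
      \<bar>(\<Sum>j=1..n. tail_prob \<mu> n p (Suc k) j A (y(Suc k := w)))
        - (\<Sum>j=1..n. tail_prob \<mu> n p (Suc k) j A (y(Suc k := w')))\<bar> \<le> c"
    and k: "k \<le> n"
  shows "(\<integral>\<^sup>+x. ennreal (exp (l * (\<Sum>j=1..n. tail_prob \<mu> n p k j A x))) * tail_integral \<mu> n k p x \<partial>pow_measure \<mu> k)
    \<le> ennreal (exp (real k * (l\<^sup>2 * c\<^sup>2 / 2) + l * (\<Sum>j=1..n. tail_prob \<mu> n p 0 j A (\<lambda>_. undefined))))"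
  using k
proof (induction k)
  case 0
  show ?case
    by (simp add: nn_integral_empty tail_integral_0 int_p)
next
  case (Suc k)
  interpret M: sigma_finite_measure \<mu> by (rule sigma_finite_mu)
  interpret MM: pair_sigma_finite \<mu> \<mu> ..
  interpret K: sigma_finite_measure "pow_measure \<mu> k" by (rule sigma_finite_pow) simp
  interpret KMM: pair_sigma_finite "pow_measure \<mu> k" "\<mu> \<Otimes>\<^sub>M \<mu>"
    by (intro pair_sigma_finite.intro K.sigma_finite_measure_axioms MM.sigma_finite_measure_axioms)
  let ?E = "\<lambda>k x. ennreal (exp (l * (\<Sum>j=1..n. tail_prob \<mu> n p k j A x))) * tail_integral \<mu> n k p x"
  have E: "?E i \<in> borel_measurable (pow_measure \<mu> i)" if "i \<le> n" for i
  proof -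
    have [measurable]: "(\<lambda>x. \<Sum>j=1..n. tail_prob \<mu> n p i j A x) \<in> borel_measurable (pow_measure \<mu> i)"
      by (intro borel_measurable_sum measurable_tail_prob that p A)
    note [measurable] = measurable_tail_integral[OF that p]
    show ?thesis by measurable
  qed
  have kn: "k \<le> n" "k < n" using Suc.prems by auto
  have fin: "AE y in pow_measure \<mu> k. tail_integral \<mu> n k p y \<noteq> \<infinity>"
    using nn_integral_tail_integral[OF kn(1) p] int_p
    by (intro nn_integral_noteq_infinite measurable_tail_integral kn p) auto
  have "(\<integral>\<^sup>+x. ?E (Suc k) x \<partial>pow_measure \<mu> (Suc k))
    = (\<integral>\<^sup>+y. (\<integral>\<^sup>+w. ?E (Suc k) (y(Suc k := w)) \<partial>\<mu>) \<partial>pow_measure \<mu> k)"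
    by (rule nn_integral_pow_Suc[OF E[OF Suc.prems]])
  also have "\<dots> \<le> (\<integral>\<^sup>+y. ennreal (exp (l\<^sup>2 * c\<^sup>2 / 2)) * ?E k y \<partial>pow_measure \<mu> k)"
  proof (rule nn_integral_mono_AE)
    \<comment> \<open>For almost every \<open>y\<close>, the null set of triples has a null section,
      and that section splits once more into iterated null sets in \<open>w\<close> and
      \<open>w'\<close>, the form used by the single step.\<close>
    show "AE y in pow_measure \<mu> k. (\<integral>\<^sup>+w. ?E (Suc k) (y(Suc k := w)) \<partial>\<mu>)
      \<le> ennreal (exp (l\<^sup>2 * c\<^sup>2 / 2)) * ?E k y"
      using fin KMM.AE_pair[OF close[OF kn(2)]] AE_space
    proof eventually_elim
      case (elim y)
      show ?case
        using MM.AE_pair[OF elim(2)] by (intro exp_moment_step[OF Suc.prems p elim(3) A l elim(1)]) auto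
    qed
  qed
  also have "\<dots> = ennreal (exp (l\<^sup>2 * c\<^sup>2 / 2)) * (\<integral>\<^sup>+y. ?E k y \<partial>pow_measure \<mu> k)"
    by (rule nn_integral_cmult[OF E[OF kn(1)]])
  also have "\<dots> \<le> ennreal (exp (l\<^sup>2 * c\<^sup>2 / 2)) *
      ennreal (exp (real k * (l\<^sup>2 * c\<^sup>2 / 2) + l * (\<Sum>j=1..n. tail_prob \<mu> n p 0 j A (\<lambda>_. undefined))))"
    by (intro mult_left_mono Suc.IH kn) simp
  also have "\<dots> = ennreal (exp (real (Suc k) * (l\<^sup>2 * c\<^sup>2 / 2) + l * (\<Sum>j=1..n. tail_prob \<mu> n p 0 j A (\<lambda>_. undefined))))"
    by (simp add: ennreal_mult[symmetric] exp_add[symmetric] algebra_simps)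
  finally show ?case .
qed

lemma tail_prob_0:
  assumes p: "p \<in> borel_measurable (pow_measure \<mu> n)" and int_p: "(\<integral>\<^sup>+x. p x \<partial>pow_measure \<mu> n) = 1"
    and A: "A \<in> sets \<mu>" and j: "j \<in> {1..n}"
  shows "tail_prob \<mu> n p 0 j A x
    = measure (density (pow_measure \<mu> n) p) {z \<in> space (pow_measure \<mu> n). z j \<in> A}"
proof -
  have B: "{z \<in> space (pow_measure \<mu> n). z j \<in> A} \<in> sets (pow_measure \<mu> n)"
    using A j by measurable
  have "(\<integral>\<^sup>+z. p z * indicator A (z j) \<partial>pow_measure \<mu> n)
    = (\<integral>\<^sup>+z. p z * indicator {z \<in> space (pow_measure \<mu> n). z j \<in> A} z \<partial>pow_measure \<mu> n)"
    by (intro nn_integral_cong) (simp split: split_indicator)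
  then show ?thesis
    unfolding tail_prob_def tail_integral_0 int_p measure_def
    by (simp only: emeasure_density[OF p B] enn2real_1 div_by_1)
qed

text \<open>Chernoff's bound: the martingale starts at the mean of the sum of indicators and at time
  \<open>n\<close> equals that sum wherever the density is positive and finite.\<close>

lemma sum_indicator_concentration:
  fixes p :: "(nat \<Rightarrow> 'a) \<Rightarrow> ennreal" and n :: nat
  assumes p: "p \<in> borel_measurable (pow_measure \<mu> n)" and int_p: "(\<integral>\<^sup>+x. p x \<partial>pow_measure \<mu> n) = 1"
    and A: "A \<in> sets \<mu>" and t: "0 < t" and c: "0 < c"
    and close: "\<And>k. k < n \<Longrightarrow> AE (y, w, w') in pow_measure \<mu> k \<Otimes>\<^sub>M (\<mu> \<Otimes>\<^sub>M \<mu>).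
      tail_integral \<mu> n (Suc k) p (y(Suc k := w)) \<notin> {0, \<infinity>} \<longrightarrow>
      tail_integral \<mu> n (Suc k) p (y(Suc k := w')) \<notin> {0, \<infinity>} \<longrightarrow>
      \<bar>(\<Sum>j=1..n. tail_prob \<mu> n p (Suc k) j A (y(Suc k := w)))
        - (\<Sum>j=1..n. tail_prob \<mu> n p (Suc k) j A (y(Suc k := w')))\<bar> \<le> c"
  defines "m \<equiv> density (pow_measure \<mu> n) p"
  shows "measure m {x \<in> space (pow_measure \<mu> n). (\<Sum>j=1..n. indicator A (x j))
      - (\<Sum>j=1..n. measure m {z \<in> space (pow_measure \<mu> n). z j \<in> A}) > real n * t}
    \<le> exp (- (real n * t\<^sup>2 / (2 * c\<^sup>2)))"
proof -
  let ?M = "pow_measure \<mu> n"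
  define s where "s = (\<Sum>j=1..n. measure m {z \<in> space ?M. z j \<in> A})"
  \<comment> \<open>The minimiser of \<open>- l * n * t + n * l\<^sup>2 * c\<^sup>2 / 2\<close>,
    with minimum \<open>- n * t\<^sup>2 / (2 * c\<^sup>2)\<close>.\<close>
  define l where "l = t / c\<^sup>2"
  have l: "0 < l" using t c by (simp add: l_def)
  have s: "(\<Sum>j=1..n. tail_prob \<mu> n p 0 j A x) = s" for x
    unfolding s_def m_def by (intro sum.cong refl tail_prob_0 p int_p A)
  let ?S = "\<lambda>x. (\<Sum>j=1..n. indicator A (x j)) :: real"
  let ?B = "{x \<in> space ?M. ?S x - s > real n * t}"
  have S[measurable]: "?S \<in> borel_measurable ?M"
    by (intro borel_measurable_sum measurable_compose[OF measurable_component_singleton borel_measurable_indicator] A)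
  have B: "?B \<in> sets ?M" by measurable
  note [measurable] = p
  have fin: "AE x in ?M. p x \<noteq> \<infinity>"
    using int_p by (intro nn_integral_noteq_infinite) auto
  have "emeasure m ?B = (\<integral>\<^sup>+x. p x * indicator ?B x \<partial>?M)"
    unfolding m_def by (rule emeasure_density[OF p B])
  also have "\<dots> \<le> (\<integral>\<^sup>+x. ennreal (exp (- l * (s + real n * t))) *
      (ennreal (exp (l * (\<Sum>j=1..n. tail_prob \<mu> n p n j A x))) * tail_integral \<mu> n n p x) \<partial>?M)"
  proof (rule nn_integral_mono_AE)
    show "AE x in ?M. p x * indicator ?B x \<le> ennreal (exp (- l * (s + real n * t))) *
      (ennreal (exp (l * (\<Sum>j=1..n. tail_prob \<mu> n p n j A x))) * tail_integral \<mu> n n p x)"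
      using fin AE_space
    proof eventually_elim
      case (elim x)
      have T: "tail_integral \<mu> n n p x = p x" by (rule tail_integral_all[OF elim(2)])
      show ?case
      proof (cases "p x \<noteq> 0 \<and> x \<in> ?B")
        case True
        \<comment> \<open>At time \<open>n\<close> every coordinate belongs to the past, so each
          \<open>tail_prob\<close> is an indicator. On the event the exponential factor is then at
          least 1, which is Markov's inequality under the integral.\<close>
        have "(\<Sum>j=1..n. tail_prob \<mu> n p n j A x) = ?S x"
          using True elim T by (intro sum.cong refl tail_prob_past[OF order_refl p elim(2)]) auto
        moreover have "ennreal (exp (- l * (s + real n * t))) * ennreal (exp (l * ?S x))
            = ennreal (exp (l * (?S x - s - real n * t)))"
          by (simp add: ennreal_mult[symmetric] exp_add[symmetric] right_diff_distrib distrib_left)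
        moreover have "1 \<le> exp (l * (?S x - s - real n * t))"
          using True l by simp
        ultimately have "p x * 1 \<le> p x * (ennreal (exp (- l * (s + real n * t)))
            * ennreal (exp (l * (\<Sum>j=1..n. tail_prob \<mu> n p n j A x))))"
          by (intro mult_left_mono) simp_all
        then show ?thesis using True by (simp add: T mult_ac)
      qed auto
    qed
  qed
  also have "\<dots> = ennreal (exp (- l * (s + real n * t))) *
      (\<integral>\<^sup>+x. ennreal (exp (l * (\<Sum>j=1..n. tail_prob \<mu> n p n j A x))) * tail_integral \<mu> n n p x \<partial>?M)"
  proof (rule nn_integral_cmult)
    have [measurable]: "(\<lambda>x. \<Sum>j=1..n. tail_prob \<mu> n p n j A x) \<in> borel_measurable ?M"
      by (intro borel_measurable_sum measurable_tail_prob order_refl p A)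
    note [measurable] = measurable_tail_integral[OF order_refl p]
    show "(\<lambda>x. ennreal (exp (l * (\<Sum>j=1..n. tail_prob \<mu> n p n j A x))) * tail_integral \<mu> n n p x)
      \<in> borel_measurable ?M" by measurable
  qed
  also have "\<dots> \<le> ennreal (exp (- l * (s + real n * t))) * ennreal (exp (real n * (l\<^sup>2 * c\<^sup>2 / 2) + l * s))"
    unfolding s[symmetric, of "\<lambda>_. undefined"]
    by (intro mult_left_mono exp_moment_bound[OF p int_p A l close order_refl]) simp_all
  also have "\<dots> = ennreal (exp (- l * (s + real n * t) + (real n * (l\<^sup>2 * c\<^sup>2 / 2) + l * s)))"
    by (simp add: ennreal_mult[symmetric] exp_add[symmetric])
  also have "- l * (s + real n * t) + (real n * (l\<^sup>2 * c\<^sup>2 / 2) + l * s) = - (real n * t\<^sup>2 / (2 * c\<^sup>2))"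
    using c by (simp add: l_def field_simps power2_eq_square)
  finally have "measure m ?B \<le> exp (- (real n * t\<^sup>2 / (2 * c\<^sup>2)))"
    unfolding measure_def by (intro enn2real_leI) simp_all
  then show ?thesis unfolding s_def .
qed

subsection \<open>Bounding conditional probabilities by mixing coefficients\<close>

text \<open>\<open>cond_law\<close> normalises by a Bochner integral and \<open>tail_prob\<close> by
  a nonnegative one. They agree because \<open>q\<close> is nonnegative and the normaliser is
  positive and finite.\<close>

lemma measure_cond_law:
  fixes q :: "(nat \<Rightarrow> 'a) \<Rightarrow> real"
  assumes ij: "i < j" "j \<le> n" and q: "q \<in> borel_measurable (pow_measure \<mu> n)"
    and nonneg: "\<And>z. z \<in> space (pow_measure \<mu> n) \<Longrightarrow> 0 \<le> q z"
    and x: "x \<in> space (pow_measure \<mu> i)"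
    and D: "tail_integral \<mu> n i (\<lambda>z. ennreal (q z)) x \<notin> {0, \<infinity>}"
    and B: "B \<in> sets (PiM {j..n} (\<lambda>_. \<mu>))"
  shows "measure (cond_law \<mu> n q i j x) B
    = enn2real (\<integral>\<^sup>+u. ennreal (q (merge {1..i} {i<..n} (x, u))) * indicator B (restrict u {j..n}) \<partial>PiM {i<..n} (\<lambda>_. \<mu>))
      / enn2real (tail_integral \<mu> n i (\<lambda>z. ennreal (q z)) x)"
proof -
  let ?J = "PiM {i<..n} (\<lambda>_. \<mu>)" and ?q = "\<lambda>u. q (merge {1..i} {i<..n} (x, u))"
  let ?D = "tail_integral \<mu> n i (\<lambda>z. ennreal (q z)) x"
  have i: "i \<le> n" using ij by simp
  note mer = measurable_merge_section[OF i x]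
  have [measurable]: "?q \<in> borel_measurable ?J" by (rule measurable_compose[OF mer q])
  have nn: "0 \<le> ?q u" if "u \<in> space ?J" for u
    by (intro nonneg measurable_space[OF mer that])
  have I: "(\<integral>v. ?q v \<partial>?J) = enn2real ?D"
    unfolding tail_integral_def using nn by (intro integral_eq_nn_integral) auto
  have ID: "ennreal (enn2real ?D) = ?D" using D by (simp add: less_top)
  have pos: "0 < enn2real ?D" using D by (simp add: enn2real_positive_iff less_top zero_less_iff_neq_zero)
  have res[measurable]: "(\<lambda>u. restrict u {j..n}) \<in> measurable ?J (PiM {j..n} (\<lambda>_. \<mu>))"
    using ij by (intro measurable_restrict_subset) auto
  let ?B = "(\<lambda>u. restrict u {j..n}) -` B \<inter> space ?J"
  have B': "?B \<in> sets ?J" by (rule measurable_sets[OF res B])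
  have "emeasure (cond_law \<mu> n q i j x) B = emeasure (density ?J (\<lambda>u. ennreal (?q u / enn2real ?D))) ?B"
    unfolding cond_law_def I by (subst emeasure_distr[OF _ B]) auto
  also have "\<dots> = (\<integral>\<^sup>+u. ennreal (?q u / enn2real ?D) * indicator ?B u \<partial>?J)"
    by (rule emeasure_density[OF _ B']) measurable
  also have "\<dots> = (\<integral>\<^sup>+u. (ennreal (?q u) * indicator B (restrict u {j..n})) / ?D \<partial>?J)"
  proof (rule nn_integral_cong)
    fix u assume u: "u \<in> space ?J"
    have "ennreal (?q u / enn2real ?D) = ennreal (?q u) / ?D"
      using divide_ennreal[OF nn[OF u] pos] by (simp only: ID)
    then show "ennreal (?q u / enn2real ?D) * indicator ?B u
        = (ennreal (?q u) * indicator B (restrict u {j..n})) / ?D"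
      using u by (simp split: split_indicator)
  qed
  also have "\<dots> = (\<integral>\<^sup>+u. ennreal (?q u) * indicator B (restrict u {j..n}) \<partial>?J) / ?D"
    by (intro nn_integral_divide borel_measurable_times_ennreal
        measurable_compose[OF res borel_measurable_indicator[OF B]]) measurable
  finally show ?thesis
    unfolding measure_def using D by (simp only: enn2real_divide_pos insert_iff empty_iff simp_thms de_Morgan_disj)
qed

text \<open>Since \<open>i < j\<close>, coordinate \<open>j\<close> of the merged point is taken
  from the future \<open>u\<close>, and it survives the restriction to the block from
  \<open>j\<close> to \<open>n\<close>.\<close>

lemma measure_cond_law_component:
  fixes q :: "(nat \<Rightarrow> 'a) \<Rightarrow> real"
  assumes ij: "i < j" "j \<le> n" and q: "q \<in> borel_measurable (pow_measure \<mu> n)"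
    and nonneg: "\<And>z. z \<in> space (pow_measure \<mu> n) \<Longrightarrow> 0 \<le> q z"
    and x: "x \<in> space (pow_measure \<mu> i)"
    and D: "tail_integral \<mu> n i (\<lambda>z. ennreal (q z)) x \<notin> {0, \<infinity>}"
    and A: "A \<in> sets \<mu>"
  shows "measure (cond_law \<mu> n q i j x) {u \<in> space (PiM {j..n} (\<lambda>_. \<mu>)). u j \<in> A}
    = tail_prob \<mu> n (\<lambda>z. ennreal (q z)) i j A x"
proof -
  let ?J = "PiM {i<..n} (\<lambda>_. \<mu>)" and ?B = "{u \<in> space (PiM {j..n} (\<lambda>_. \<mu>)). u j \<in> A}"
  have jn: "j \<in> {j..n}" using ij by simp
  have B: "?B \<in> sets (PiM {j..n} (\<lambda>_. \<mu>))"
    using A jn by measurable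
  have res: "(\<lambda>u. restrict u {j..n}) \<in> measurable ?J (PiM {j..n} (\<lambda>_. \<mu>))"
    using ij by (intro measurable_restrict_subset) auto
  have "indicator ?B (restrict u {j..n}) = (indicator A (merge {1..i} {i<..n} (x, u) j) :: ennreal)"
    if "u \<in> space ?J" for u
    using measurable_space[OF res that] ij by (auto simp: merge_def split: split_indicator)
  then have "(\<integral>\<^sup>+u. ennreal (q (merge {1..i} {i<..n} (x, u))) * indicator ?B (restrict u {j..n}) \<partial>?J)
    = tail_integral \<mu> n i (\<lambda>z. ennreal (q z) * indicator A (z j)) x"
    unfolding tail_integral_def by (intro nn_integral_cong) simp
  then show ?thesis
    by (subst measure_cond_law[OF ij q nonneg x D B]) (simp_all add: tail_prob_def)
qed

lemma measure_cond_law_space: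
  fixes q :: "(nat \<Rightarrow> 'a) \<Rightarrow> real"
  assumes ij: "i < j" "j \<le> n" and q: "q \<in> borel_measurable (pow_measure \<mu> n)"
    and nonneg: "\<And>z. z \<in> space (pow_measure \<mu> n) \<Longrightarrow> 0 \<le> q z"
    and x: "x \<in> space (pow_measure \<mu> i)"
    and D: "tail_integral \<mu> n i (\<lambda>z. ennreal (q z)) x \<notin> {0, \<infinity>}"
  shows "measure (cond_law \<mu> n q i j x) (space (PiM {j..n} (\<lambda>_. \<mu>))) = 1"
proof -
  let ?J = "PiM {i<..n} (\<lambda>_. \<mu>)"
  have res: "(\<lambda>u. restrict u {j..n}) \<in> measurable ?J (PiM {j..n} (\<lambda>_. \<mu>))"
    using ij by (intro measurable_restrict_subset) auto
  have "(\<integral>\<^sup>+u. ennreal (q (merge {1..i} {i<..n} (x, u)))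
      * indicator (space (PiM {j..n} (\<lambda>_. \<mu>))) (restrict u {j..n}) \<partial>?J)
    = tail_integral \<mu> n i (\<lambda>z. ennreal (q z)) x"
    unfolding tail_integral_def
    by (intro nn_integral_cong) (simp add: measurable_space[OF res])
  moreover have "enn2real (tail_integral \<mu> n i (\<lambda>z. ennreal (q z)) x) \<noteq> 0"
    using D by (simp add: enn2real_eq_0_iff)
  ultimately show ?thesis
    by (subst measure_cond_law[OF ij q nonneg x D sets.top]) simp_all
qed

text \<open>The event that coordinate \<open>j\<close> lies in \<open>A\<close> is one of the sets
  tested by the norm on the block from \<open>j\<close> to \<open>n\<close>. Both laws have mass 1,
  so the complement flips the sign and the norm dominates the full difference.\<close>

lemma tail_prob_diff_le_tv_norm:
  fixes q :: "(nat \<Rightarrow> 'a) \<Rightarrow> real"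
  assumes ij: "i < j" "j \<le> n" and q: "q \<in> borel_measurable (pow_measure \<mu> n)"
    and nonneg: "\<And>z. z \<in> space (pow_measure \<mu> n) \<Longrightarrow> 0 \<le> q z"
    and x: "x \<in> space (pow_measure \<mu> i)" "x' \<in> space (pow_measure \<mu> i)"
    and D: "tail_integral \<mu> n i (\<lambda>z. ennreal (q z)) x \<notin> {0, \<infinity>}"
      "tail_integral \<mu> n i (\<lambda>z. ennreal (q z)) x' \<notin> {0, \<infinity>}"
    and A: "A \<in> sets \<mu>"
  shows "ereal \<bar>tail_prob \<mu> n (\<lambda>z. ennreal (q z)) i j A x - tail_prob \<mu> n (\<lambda>z. ennreal (q z)) i j A x'\<bar>
    \<le> tv_norm (PiM {j..n} (\<lambda>_. \<mu>))
      (\<lambda>B. measure (cond_law \<mu> n q i j x) B - measure (cond_law \<mu> n q i j x') B)"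
proof -
  let ?N = "PiM {j..n} (\<lambda>_. \<mu>)" and ?m = "\<lambda>x. cond_law \<mu> n q i j x"
  let ?B = "{u \<in> space ?N. u j \<in> A}"
  have jn: "j \<in> {j..n}" using ij by simp
  have B: "?B \<in> sets ?N"
    using A jn by measurable
  have m: "measure (?m x) ?B = tail_prob \<mu> n (\<lambda>z. ennreal (q z)) i j A x"
     "measure (?m x) (space ?N - ?B) = 1 - tail_prob \<mu> n (\<lambda>z. ennreal (q z)) i j A x"
    if x: "x \<in> space (pow_measure \<mu> i)" and D: "tail_integral \<mu> n i (\<lambda>z. ennreal (q z)) x \<notin> {0, \<infinity>}" for x
  proof -
    show 1: "measure (?m x) ?B = tail_prob \<mu> n (\<lambda>z. ennreal (q z)) i j A x"
      by (rule measure_cond_law_component[OF ij q nonneg x D A])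
    have sp: "space (?m x) = space ?N" and st: "sets (?m x) = sets ?N"
      by (simp_all add: cond_law_def)
    have 2: "measure (?m x) (space ?N) = 1"
      by (rule measure_cond_law_space[OF ij q nonneg x D])
    \<comment> \<open>\<open>measure\<close> returns 0 on sets of infinite mass, so the value 1
      forces finiteness.\<close>
    then have "emeasure (?m x) (space (?m x)) \<noteq> \<infinity>"
      by (auto simp: measure_def sp)
    then interpret finite_measure "?m x" by (rule finite_measureI)
    show "measure (?m x) (space ?N - ?B) = 1 - tail_prob \<mu> n (\<lambda>z. ennreal (q z)) i j A x"
      using finite_measure_compl[of ?B] B 1 2 by (simp add: sp st)
  qed
  show ?thesis
    using abs_le_tv_norm[of ?B ?N "\<lambda>B. measure (?m x) B - measure (?m x') B"] B m[OF x(1) D(1)] m[OF x(2) D(2)]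
    by simp
qed

section \<open>Continuity of conditional probabilities in the density\<close>

lemma tail_integral_diff_le:
  fixes f g :: "(nat \<Rightarrow> 'a) \<Rightarrow> real"
  assumes i: "i \<le> n" and x: "x \<in> space (pow_measure \<mu> i)"
    and f: "f \<in> borel_measurable (pow_measure \<mu> n)" and g: "g \<in> borel_measurable (pow_measure \<mu> n)"
    and A: "A \<in> sets \<mu>" and j: "j \<in> {1..n}"
  shows "tail_integral \<mu> n i (\<lambda>z. ennreal (f z) * indicator A (z j)) x
    \<le> tail_integral \<mu> n i (\<lambda>z. ennreal (g z) * indicator A (z j)) x + tail_integral \<mu> n i (\<lambda>z. ennreal \<bar>f z - g z\<bar>) x"
proof -
  let ?J = "PiM {i<..n} (\<lambda>_. \<mu>)" and ?m = "\<lambda>u. merge {1..i} {i<..n} (x, u)"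
  note mer = measurable_merge_section[OF i x]
  have m: "(\<lambda>u. ennreal (g (?m u)) * indicator A (?m u j)) \<in> borel_measurable ?J"
    by (rule measurable_compose[OF mer measurable_mult_indicator_component[OF _ A j]]) (use g in measurable)
  have m': "(\<lambda>u. ennreal \<bar>f (?m u) - g (?m u)\<bar>) \<in> borel_measurable ?J"
    by (rule measurable_compose[OF mer]) (use f g in measurable)
  have "tail_integral \<mu> n i (\<lambda>z. ennreal (f z) * indicator A (z j)) x
    \<le> (\<integral>\<^sup>+u. ennreal (g (?m u)) * indicator A (?m u j) + ennreal \<bar>f (?m u) - g (?m u)\<bar> \<partial>?J)"
    unfolding tail_integral_def
  proof (rule nn_integral_mono)
    fix u
    \<comment> \<open>\<open>ennreal\<close> sends negative reals to 0, hence the positive part of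
      \<open>g\<close>.\<close>
    have "ennreal (f (?m u)) \<le> ennreal (max 0 (g (?m u)) + \<bar>f (?m u) - g (?m u)\<bar>)"
      by (rule ennreal_leI) linarith
    also have "\<dots> = ennreal (g (?m u)) + ennreal \<bar>f (?m u) - g (?m u)\<bar>"
      by (simp add: ennreal_plus max_def ennreal_neg)
    finally show "ennreal (f (?m u)) * indicator A (?m u j)
      \<le> ennreal (g (?m u)) * indicator A (?m u j) + ennreal \<bar>f (?m u) - g (?m u)\<bar>"
      by (simp split: split_indicator)
  qed
  also have "\<dots> = tail_integral \<mu> n i (\<lambda>z. ennreal (g z) * indicator A (z j)) x
      + tail_integral \<mu> n i (\<lambda>z. ennreal \<bar>f z - g z\<bar>) x"
    unfolding tail_integral_def by (rule nn_integral_add[OF m m'])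
  finally show ?thesis .
qed

text \<open>The preceding estimate, used in both directions, bounds the difference of the two
  integrals by the tail integral of \<open>\<bar>q k - p\<bar>\<close>, which tends to 0.\<close>

lemma tail_integral_tendsto:
  fixes q :: "nat \<Rightarrow> (nat \<Rightarrow> 'a) \<Rightarrow> real" and p :: "(nat \<Rightarrow> 'a) \<Rightarrow> real"
  assumes i: "i \<le> n" and x: "x \<in> space (pow_measure \<mu> i)"
    and p: "p \<in> borel_measurable (pow_measure \<mu> n)" and q: "\<And>k. q k \<in> borel_measurable (pow_measure \<mu> n)"
    and A: "A \<in> sets \<mu>" and j: "j \<in> {1..n}"
    and efin: "\<And>k. tail_integral \<mu> n i (\<lambda>z. ennreal \<bar>q k z - p z\<bar>) x \<noteq> \<infinity>"
    and lim: "(\<lambda>k. enn2real (tail_integral \<mu> n i (\<lambda>z. ennreal \<bar>q k z - p z\<bar>) x)) \<longlonglongrightarrow> 0"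
    and fin: "tail_integral \<mu> n i (\<lambda>z. ennreal (p z) * indicator A (z j)) x \<noteq> \<infinity>"
  shows "(\<lambda>k. enn2real (tail_integral \<mu> n i (\<lambda>z. ennreal (q k z) * indicator A (z j)) x))
    \<longlonglongrightarrow> enn2real (tail_integral \<mu> n i (\<lambda>z. ennreal (p z) * indicator A (z j)) x)"
proof (rule LIM_zero_cancel, rule Lim_null_comparison[OF _ lim], intro always_eventually allI)
  fix k
  let ?T = "\<lambda>f. tail_integral \<mu> n i (\<lambda>z. ennreal (f z) * indicator A (z j)) x"
  let ?e = "tail_integral \<mu> n i (\<lambda>z. ennreal \<bar>q k z - p z\<bar>) x"
  have 1: "?T (q k) \<le> ?T p + ?e" by (rule tail_integral_diff_le[OF i x q p A j])
  have 2: "?T p \<le> ?T (q k) + ?e"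
    using tail_integral_diff_le[OF i x p q[of k] A j] by (simp add: abs_minus_commute)
  have "?T (q k) \<noteq> \<infinity>"
    using 1 fin efin[of k] by (auto simp: top_unique)
  then obtain a b e where "?T (q k) = ennreal a" "?T p = ennreal b" "?e = ennreal e" "0 \<le> a" "0 \<le> b" "0 \<le> e"
    using fin efin[of k] by (cases "?T (q k)"; cases "?T p"; cases ?e) auto
  then show "norm (enn2real (?T (q k)) - enn2real (?T p)) \<le> enn2real ?e"
    using 1 2 by (simp add: ennreal_plus[symmetric] abs_le_iff del: ennreal_plus)
qed

text \<open>Carries statements about almost every past of length \<open>Suc k\<close> over to the
  triples on which the essential supremum in \<open>eta_bar_pos\<close> is taken. Under either
  extension of \<open>y\<close>, the preimage of a null set is null by Tonelli's theorem.\<close>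

lemma AE_pow_Suc_pair:
  assumes "AE x in pow_measure \<mu> (Suc k). Q x"
  shows "AE (y, w, w') in pow_measure \<mu> k \<Otimes>\<^sub>M (\<mu> \<Otimes>\<^sub>M \<mu>). Q (y(Suc k := w)) \<and> Q (y(Suc k := w'))"
proof -
  interpret M: sigma_finite_measure \<mu> by (rule sigma_finite_mu)
  interpret MM: pair_sigma_finite \<mu> \<mu> ..
  interpret K: sigma_finite_measure "pow_measure \<mu> k" by (rule sigma_finite_pow) simp
  interpret KMM: pair_sigma_finite "pow_measure \<mu> k" "\<mu> \<Otimes>\<^sub>M \<mu>"
    by (intro pair_sigma_finite.intro K.sigma_finite_measure_axioms MM.sigma_finite_measure_axioms)
  let ?P = "pow_measure \<mu> k \<Otimes>\<^sub>M (\<mu> \<Otimes>\<^sub>M \<mu>)"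
  \<comment> \<open>\<open>Q\<close> may fail to be measurable, so the argument runs on a measurable
    null set covering its failures.\<close>
  obtain N where N: "N \<in> sets (pow_measure \<mu> (Suc k))" "emeasure (pow_measure \<mu> (Suc k)) N = 0"
      "{x \<in> space (pow_measure \<mu> (Suc k)). \<not> Q x} \<subseteq> N"
    using assms unfolding eventually_ae_filter by (auto simp: null_sets_def)
  have upd: "(\<lambda>v. (fst v)(Suc k := h (snd v))) \<in> measurable ?P (pow_measure \<mu> (Suc k))"
    if "h \<in> measurable (\<mu> \<Otimes>\<^sub>M \<mu>) \<mu>" for h
    using that by (intro measurable_fun_upd[where J = "{1..k}"]) auto
  have "0 = (\<integral>\<^sup>+x. indicator N x \<partial>pow_measure \<mu> (Suc k))"
    using N by simp
  also have "\<dots> = (\<integral>\<^sup>+y. (\<integral>\<^sup>+w. indicator N (y(Suc k := w)) \<partial>\<mu>) \<partial>pow_measure \<mu> k)"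
    using N(1) by (intro nn_integral_pow_Suc) auto
  finally have z: "(\<integral>\<^sup>+y. (\<integral>\<^sup>+w. indicator N (y(Suc k := w)) \<partial>\<mu>) \<partial>pow_measure \<mu> k) = 0" by simp
  have upd2: "(\<lambda>(y, w). y(Suc k := w)) \<in> measurable (pow_measure \<mu> k \<Otimes>\<^sub>M \<mu>) (pow_measure \<mu> (Suc k))"
    using measurable_add_dim[of "Suc k" "{1..k}" "\<lambda>_. \<mu>"] by (simp add: Suc_interval_insert)
  have "(\<lambda>y. \<integral>\<^sup>+w. indicator N (y(Suc k := w)) \<partial>\<mu>) \<in> borel_measurable (pow_measure \<mu> k)"
    using measurable_compose[OF upd2 borel_measurable_indicator[OF N(1)]]
    by (intro M.borel_measurable_nn_integral) (simp add: case_prod_beta')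
  then have "AE y in pow_measure \<mu> k. (\<integral>\<^sup>+w. indicator N (y(Suc k := w)) \<partial>\<mu>) = 0"
    using z by (simp add: nn_integral_0_iff_AE)
  then have ae: "AE y in pow_measure \<mu> k. AE w in \<mu>. y(Suc k := w) \<notin> N"
    using AE_space
  proof eventually_elim
    case (elim y)
    have "(\<lambda>w. indicator N (y(Suc k := w)) :: ennreal) \<in> borel_measurable \<mu>"
      by (rule measurable_compose[OF measurable_upd_Suc[OF elim(2)] borel_measurable_indicator[OF N(1)]])
    then have "AE w in \<mu>. indicator N (y(Suc k := w)) = (0 :: ennreal)"
      using elim(1) by (simp add: nn_integral_0_iff_AE)
    then show ?case by (auto simp: indicator_eq_0_iff)
  qed
  \<comment> \<open>\<open>h\<close> will be one of the two projections of
    \<open>\<mu> \<Otimes>\<^sub>M \<mu>\<close>; its second condition says that preimages of null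
    sets are null.\<close>
  have comp: "AE v in ?P. (fst v)(Suc k := h (snd v)) \<notin> N"
    if h: "h \<in> measurable (\<mu> \<Otimes>\<^sub>M \<mu>) \<mu>"
      and hae: "\<And>R. (AE w in \<mu>. R w) \<Longrightarrow> AE w in \<mu> \<Otimes>\<^sub>M \<mu>. R (h w)" for h
  proof (rule KMM.AE_pair_measure)
    show "{v \<in> space ?P. (fst v)(Suc k := h (snd v)) \<notin> N} \<in> sets ?P"
      using measurable_sets[OF upd[OF h] sets.compl_sets[OF N(1)]] measurable_space[OF upd[OF h]]
      by (auto elim!: back_subst[where P = "\<lambda>S. S \<in> sets ?P"])
    show "AE y in pow_measure \<mu> k. AE v in \<mu> \<Otimes>\<^sub>M \<mu>. (fst (y, v))(Suc k := h (snd (y, v))) \<notin> N"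
      using ae
    proof eventually_elim
      case (elim y)
      show ?case using hae[OF elim] by simp
    qed
  qed
  have hae: "AE v in \<mu> \<Otimes>\<^sub>M \<mu>. R (fst v)" "AE v in \<mu> \<Otimes>\<^sub>M \<mu>. R (snd v)" if R: "AE w in \<mu>. R w" for R
  proof -
    obtain N' where N': "N' \<in> sets \<mu>" "emeasure \<mu> N' = 0" "{x \<in> space \<mu>. \<not> R x} \<subseteq> N'"
      using R unfolding eventually_ae_filter by (auto simp: null_sets_def)
    have N'': "AE w in \<mu>. w \<notin> N'"
      using N' by (intro AE_not_in) (simp add: null_sets_def)
    have "AE w in \<mu>. AE w' in \<mu>. w \<notin> N'"
      using N'' by eventually_elim simp
    then have "AE v in \<mu> \<Otimes>\<^sub>M \<mu>. fst v \<notin> N'"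
      using N'(1) by (intro MM.AE_pair_measure) simp_all
    moreover have "AE v in \<mu> \<Otimes>\<^sub>M \<mu>. snd v \<notin> N'"
      using N'(1) N'' by (intro MM.AE_pair_measure) simp_all
    ultimately have "AE v in \<mu> \<Otimes>\<^sub>M \<mu>. R (fst v) \<and> R (snd v)"
      using AE_space by eventually_elim (use N'(3) in \<open>auto simp: space_pair_measure\<close>)
    then show "AE v in \<mu> \<Otimes>\<^sub>M \<mu>. R (fst v)" "AE v in \<mu> \<Otimes>\<^sub>M \<mu>. R (snd v)"
      by auto
  qed
  have "AE v in ?P. (fst v)(Suc k := fst (snd v)) \<notin> N" "AE v in ?P. (fst v)(Suc k := snd (snd v)) \<notin> N"
    using hae by (auto intro!: comp)
  then show ?thesis
    using AE_space
  proof eventually_elim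
    case (elim v)
    have "(fst v)(Suc k := fst (snd v)) \<in> space (pow_measure \<mu> (Suc k))"
      "(fst v)(Suc k := snd (snd v)) \<in> space (pow_measure \<mu> (Suc k))"
      using measurable_space[OF upd elim(3)] by auto
    then show ?case using elim N(3) by (auto simp: case_prod_beta)
  qed
qed

lemma pos_pdf_integrable:
  assumes "pos_pdf \<mu> n q"
  shows "integrable (pow_measure \<mu> n) q" "q \<in> borel_measurable (pow_measure \<mu> n)"
    "x \<in> space (pow_measure \<mu> n) \<Longrightarrow> 0 \<le> q x"
proof -
  show q: "q \<in> borel_measurable (pow_measure \<mu> n)"
    and nonneg: "\<And>x. x \<in> space (pow_measure \<mu> n) \<Longrightarrow> 0 \<le> q x"
    using assms by (auto simp: pos_pdf_def less_imp_le)
  interpret prob_space "density (pow_measure \<mu> n) (\<lambda>x. ennreal (q x))"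
    using assms by (simp add: pos_pdf_def)
  have "(\<integral>\<^sup>+x. ennreal (q x) \<partial>pow_measure \<mu> n) = 1"
    using emeasure_space_1 q by (simp add: emeasure_density cong: nn_integral_cong)
  then show "integrable (pow_measure \<mu> n) q"
    using q nonneg by (intro integrableI_nonneg) auto
qed

text \<open>By Tonelli's theorem the tail integrals of \<open>\<bar>q k - p\<bar>\<close> have the
  L1 distances as their integrals. They thus tend to 0 in L1 over the pasts, and almost everywhere
  along a subsequence.\<close>

lemma AE_subseq_tail_integral_tendsto_0:
  fixes q :: "nat \<Rightarrow> (nat \<Rightarrow> 'a) \<Rightarrow> real" and p :: "(nat \<Rightarrow> 'a) \<Rightarrow> real"
  assumes i: "i \<le> n" and p: "integrable (pow_measure \<mu> n) p" and q: "\<And>k. integrable (pow_measure \<mu> n) (q k)"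
    and lim: "(\<lambda>k. \<integral>x. \<bar>q k x - p x\<bar> \<partial>pow_measure \<mu> n) \<longlonglongrightarrow> 0"
  obtains r :: "nat \<Rightarrow> nat" where "strict_mono r"
    "AE x in pow_measure \<mu> i. \<forall>k. tail_integral \<mu> n i (\<lambda>z. ennreal \<bar>q k z - p z\<bar>) x \<noteq> \<infinity>"
    "AE x in pow_measure \<mu> i. (\<lambda>k. enn2real (tail_integral \<mu> n i (\<lambda>z. ennreal \<bar>q (r k) z - p z\<bar>) x)) \<longlonglongrightarrow> 0"
proof -
  let ?e = "\<lambda>k. tail_integral \<mu> n i (\<lambda>z. ennreal \<bar>q k z - p z\<bar>)"
  have d: "integrable (pow_measure \<mu> n) (\<lambda>x. \<bar>q k x - p x\<bar>)" for k
    using p q[of k] by simp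
  have md: "(\<lambda>x. ennreal \<bar>q k x - p x\<bar>) \<in> borel_measurable (pow_measure \<mu> n)" for k
    using borel_measurable_integrable[OF d[of k]] by simp
  note e = measurable_tail_integral[OF i md]
  have eint: "(\<integral>\<^sup>+x. ?e k x \<partial>pow_measure \<mu> i) = ennreal (\<integral>x. \<bar>q k x - p x\<bar> \<partial>pow_measure \<mu> n)" for k
    using nn_integral_tail_integral[OF i md] nn_integral_eq_integral[OF d[of k]] by simp
  have fin: "AE x in pow_measure \<mu> i. ?e k x \<noteq> \<infinity>" for k
    by (rule nn_integral_noteq_infinite[OF e]) (simp add: eint)
  have eq: "(\<integral>\<^sup>+x. ennreal (enn2real (?e k x)) \<partial>pow_measure \<mu> i) = ennreal (\<integral>x. \<bar>q k x - p x\<bar> \<partial>pow_measure \<mu> n)" for k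
    unfolding eint[symmetric] using fin[of k] by (intro nn_integral_cong_AE) (auto simp: less_top)
  have m: "(\<lambda>x. enn2real (?e k x)) \<in> borel_measurable (pow_measure \<mu> i)" for k
    using e[of k] by measurable
  have int: "integrable (pow_measure \<mu> i) (\<lambda>x. enn2real (?e k x))" for k
    using m[of k] eq[of k] by (intro integrableI_nonneg) auto
  have "(\<integral>x. norm (enn2real (?e k x)) \<partial>pow_measure \<mu> i) = (\<integral>x. \<bar>q k x - p x\<bar> \<partial>pow_measure \<mu> n)" for k
    using m[of k] by (simp add: integral_eq_nn_integral eq)
  then have "(\<lambda>k. \<integral>x. norm (enn2real (?e k x)) \<partial>pow_measure \<mu> i) \<longlonglongrightarrow> 0"
    using lim by (simp only:)
  then obtain r where "strict_mono r" "AE x in pow_measure \<mu> i. (\<lambda>k. enn2real (?e (r k) x)) \<longlonglongrightarrow> 0"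
    using tendsto_L1_AE_subseq[of "pow_measure \<mu> i" "\<lambda>k x. enn2real (?e k x)", OF int] by blast
  then show thesis
    using fin by (intro that) (auto simp: AE_all_countable)
qed

text \<open>The strict inequality yields one sequence of positive densities whose coefficients tend
  to a limit below \<open>c\<close>. Along a subsequence their conditional probabilities converge at
  almost every nondegenerate past, and the bound by \<open>c\<close> passes to the limit.\<close>

lemma AE_tail_prob_diff_le:
  fixes p :: "(nat \<Rightarrow> 'a) \<Rightarrow> real"
  assumes kj: "Suc k < j" "j \<le> n" and p: "integrable (pow_measure \<mu> n) p" "\<And>x. 0 \<le> p x"
    and A: "A \<in> sets \<mu>"
    and c: "eta_bar \<mu> n (density (pow_measure \<mu> n) (\<lambda>x. ennreal (p x))) (Suc k) j < ereal c"
  defines "P \<equiv> \<lambda>z. ennreal (p z)"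
  shows "AE (y, w, w') in pow_measure \<mu> k \<Otimes>\<^sub>M (\<mu> \<Otimes>\<^sub>M \<mu>).
      tail_integral \<mu> n (Suc k) P (y(Suc k := w)) \<notin> {0, \<infinity>} \<longrightarrow>
      tail_integral \<mu> n (Suc k) P (y(Suc k := w')) \<notin> {0, \<infinity>} \<longrightarrow>
      \<bar>tail_prob \<mu> n P (Suc k) j A (y(Suc k := w)) - tail_prob \<mu> n P (Suc k) j A (y(Suc k := w'))\<bar> \<le> c"
proof -
  let ?M = "pow_measure \<mu> n" and ?i = "Suc k"
  let ?T = "\<lambda>f. tail_integral \<mu> n ?i f" and ?t = "\<lambda>f. tail_prob \<mu> n (\<lambda>z. ennreal (f z)) ?i j A"
  let ?tv = "\<lambda>f. tv_norm ?M (\<lambda>A. measure (density ?M (\<lambda>x. ennreal (f x))) A - measure (density ?M (\<lambda>x. ennreal (p x))) A)"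
  have ij: "?i \<le> n" "j \<in> {1..n}" using kj by auto
  have pm: "p \<in> borel_measurable ?M" using p(1) by simp
  obtain L q where L: "L < ereal c" and pdf: "\<And>k. pos_pdf \<mu> n (q k)"
    and tv: "(\<lambda>k. ?tv (q k)) \<longlonglongrightarrow> 0"
    and eta: "(\<lambda>k. eta_bar_pos \<mu> n (q k) ?i j) \<longlonglongrightarrow> L"
    using c unfolding eta_bar_def Inf_less_iff by blast
  note q = pos_pdf_integrable[OF pdf]
  have "(\<lambda>k. ereal ((\<integral>x. \<bar>q k x - p x\<bar> \<partial>?M) / 2)) \<longlonglongrightarrow> 0"
  proof (rule tendsto_sandwich[OF _ _ tendsto_const tv]; intro always_eventually allI)
    fix l
    show "0 \<le> ereal ((\<integral>x. \<bar>q l x - p x\<bar> \<partial>?M) / 2)" by (simp add: zero_ereal_def)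
    show "ereal ((\<integral>x. \<bar>q l x - p x\<bar> \<partial>?M) / 2) \<le> ?tv (q l)"
      by (rule L1_dist_le_tv_norm[OF p q(1,3)])
  qed
  then have "(\<lambda>k. (\<integral>x. \<bar>q k x - p x\<bar> \<partial>?M) / 2 * 2) \<longlonglongrightarrow> 0 * 2"
    by (intro tendsto_mult tendsto_const) (simp add: zero_ereal_def)
  then have L1: "(\<lambda>k. \<integral>x. \<bar>q k x - p x\<bar> \<partial>?M) \<longlonglongrightarrow> 0" by simp
  obtain r where r: "strict_mono r"
    and efin: "AE x in pow_measure \<mu> ?i. \<forall>k. ?T (\<lambda>z. ennreal \<bar>q k z - p z\<bar>) x \<noteq> \<infinity>"
    and elim: "AE x in pow_measure \<mu> ?i. (\<lambda>k. enn2real (?T (\<lambda>z. ennreal \<bar>q (r k) z - p z\<bar>) x)) \<longlonglongrightarrow> 0"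
    using AE_subseq_tail_integral_tendsto_0[OF ij(1) p(1) q(1) L1] by blast
  have conv: "(\<lambda>k. ?t (q (r k)) x) \<longlonglongrightarrow> ?t p x"
      "\<forall>\<^sub>F k in sequentially. ?T (\<lambda>z. ennreal (q (r k) z)) x \<notin> {0, \<infinity>}"
    if x: "x \<in> space (pow_measure \<mu> ?i)" and D: "?T P x \<notin> {0, \<infinity>}"
      and ef: "\<forall>k. ?T (\<lambda>z. ennreal \<bar>q k z - p z\<bar>) x \<noteq> \<infinity>"
      and el: "(\<lambda>k. enn2real (?T (\<lambda>z. ennreal \<bar>q (r k) z - p z\<bar>) x)) \<longlonglongrightarrow> 0" for x
  proof -
    have T: "(\<lambda>k. enn2real (?T (\<lambda>z. ennreal (q (r k) z) * indicator C (z j)) x))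
      \<longlonglongrightarrow> enn2real (?T (\<lambda>z. ennreal (p z) * indicator C (z j)) x)" if C: "C \<in> sets \<mu>" for C
    proof (rule tail_integral_tendsto[OF ij(1) x pm q(2) C ij(2) _ el])
      show "?T (\<lambda>z. ennreal \<bar>q (r k) z - p z\<bar>) x \<noteq> \<infinity>" for k using ef by blast
      show "?T (\<lambda>z. ennreal (p z) * indicator C (z j)) x \<noteq> \<infinity>"
        using tail_integral_indicator_le[of n ?i P C j x] D by (auto simp: P_def top_unique)
    qed
    \<comment> \<open>With \<open>C = space \<mu>\<close>, the convergence \<open>T\<close> of the
      numerators becomes the convergence of the normalisers.\<close>
    have sp: "?T (\<lambda>z. f z * indicator (space \<mu>) (z j)) x = ?T f x" for f
      unfolding tail_integral_def
    proof (rule nn_integral_cong)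
      fix u assume "u \<in> space (PiM {?i<..n} (\<lambda>_. \<mu>))"
      then have "merge {1..?i} {?i<..n} (x, u) \<in> space ?M"
        by (rule measurable_space[OF measurable_merge_section[OF ij(1) x]])
      then have "merge {1..?i} {?i<..n} (x, u) j \<in> space \<mu>"
        using ij(2) by (auto simp: space_PiM)
      then show "f (merge {1..?i} {?i<..n} (x, u)) * indicator (space \<mu>) (merge {1..?i} {?i<..n} (x, u) j)
        = f (merge {1..?i} {?i<..n} (x, u))" by simp
    qed
    have T1: "(\<lambda>k. enn2real (?T (\<lambda>z. ennreal (q (r k) z)) x)) \<longlonglongrightarrow> enn2real (?T P x)"
      using T[OF sets.top] unfolding sp P_def .
    have pos: "0 < enn2real (?T P x)"
      using D by (simp add: enn2real_positive_iff less_top zero_less_iff_neq_zero)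
    show "(\<lambda>k. ?t (q (r k)) x) \<longlonglongrightarrow> ?t p x"
      unfolding tail_prob_def
      by (rule tendsto_divide[OF T[OF A] T1[unfolded P_def]]) (use pos in \<open>simp add: P_def\<close>)
    \<comment> \<open>\<open>enn2real\<close> sends both 0 and \<infinity> to 0, so a positive limit
      eventually excludes both.\<close>
    show "\<forall>\<^sub>F k in sequentially. ?T (\<lambda>z. ennreal (q (r k) z)) x \<notin> {0, \<infinity>}"
      using order_tendstoD(1)[OF T1 pos] by eventually_elim auto
  qed
  have "\<forall>\<^sub>F k in sequentially. eta_bar_pos \<mu> n (q (r k)) ?i j < ereal c"
    using order_tendstoD(2)[OF LIMSEQ_subseq_LIMSEQ[OF eta r] L] by (simp add: comp_def)
  then obtain K where K: "\<And>l. K \<le> l \<Longrightarrow> eta_bar_pos \<mu> n (q (r l)) ?i j < ereal c"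
    by (auto simp: eventually_sequentially)
  have "AE (y, w, w') in pow_measure \<mu> k \<Otimes>\<^sub>M (\<mu> \<Otimes>\<^sub>M \<mu>). eta_cond \<mu> n (q (r l)) ?i j y w w' \<le> ereal c"
    if l: "K \<le> l" for l
  proof -
    have ivl: "{1..<Suc k} = {1..k}" by auto
    obtain c' where "c' < ereal c"
      "AE (y, w, w') in pow_measure \<mu> k \<Otimes>\<^sub>M (\<mu> \<Otimes>\<^sub>M \<mu>). eta_cond \<mu> n (q (r l)) ?i j y w w' \<le> c'"
      using K[OF l] unfolding eta_bar_pos_def Inf_less_iff ivl by auto
    then show ?thesis
      by (auto elim!: eventually_mono)
  qed
  \<comment> \<open>The exceptional sets, one for each \<open>l\<close>, are united so that a single
    triple serves the whole sequence.\<close>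
  then have "AE v in pow_measure \<mu> k \<Otimes>\<^sub>M (\<mu> \<Otimes>\<^sub>M \<mu>). \<forall>l. K \<le> l \<longrightarrow>
      eta_cond \<mu> n (q (r l)) ?i j (fst v) (fst (snd v)) (snd (snd v)) \<le> ereal c"
    unfolding AE_all_countable by (auto simp: case_prod_beta')
  moreover note AE_pow_Suc_pair[OF efin] AE_pow_Suc_pair[OF elim] AE_pow_Suc_pair[OF AE_space]
  ultimately show ?thesis
  proof eventually_elim
    case (elim v)
    obtain y w w' where v: "v = (y, w, w')" by (cases v) auto
    let ?x = "y(?i := w)" and ?x' = "y(?i := w')"
    have "\<bar>?t p ?x - ?t p ?x'\<bar> \<le> c" if D: "?T P ?x \<notin> {0, \<infinity>}" "?T P ?x' \<notin> {0, \<infinity>}"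
    proof -
      have x: "?x \<in> space (pow_measure \<mu> ?i)" "?x' \<in> space (pow_measure \<mu> ?i)"
        using elim(4) by (auto simp: v)
      note c1 = conv[OF x(1) D(1)] and c2 = conv[OF x(2) D(2)]
      have lim: "(\<lambda>l. \<bar>?t (q (r l)) ?x - ?t (q (r l)) ?x'\<bar>) \<longlonglongrightarrow> \<bar>?t p ?x - ?t p ?x'\<bar>"
        using elim(2,3) by (intro tendsto_rabs tendsto_diff c1(1) c2(1)) (auto simp: v)
      have ev: "\<forall>\<^sub>F l in sequentially. ?T (\<lambda>z. ennreal (q (r l) z)) ?x \<notin> {0, \<infinity>}"
        "\<forall>\<^sub>F l in sequentially. ?T (\<lambda>z. ennreal (q (r l) z)) ?x' \<notin> {0, \<infinity>}"
        using elim(2,3) by (intro c1(2) c2(2); auto simp: v)+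
      have "\<forall>\<^sub>F l in sequentially. \<bar>?t (q (r l)) ?x - ?t (q (r l)) ?x'\<bar> \<le> c"
        using ev eventually_ge_at_top[of K]
      proof eventually_elim
        case (elim l)
        have "ereal \<bar>?t (q (r l)) ?x - ?t (q (r l)) ?x'\<bar> \<le> eta_cond \<mu> n (q (r l)) ?i j y w w'"
          unfolding eta_cond_def
          by (rule tail_prob_diff_le_tv_norm[OF kj q(2,3) x elim(1,2) A])
        also have "\<dots> \<le> ereal c"
          using \<open>\<forall>l. K \<le> l \<longrightarrow> _ l\<close> elim(3) by (auto simp: v)
        finally show ?case by simp
      qed
      then show ?thesis
        by (rule tendsto_upperbound[OF lim]) simp
    qed
    then show ?case by (auto simp: v P_def)
  qed
qed

section \<open>The mixing coefficients are at most 1\<close>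

text \<open>For a past with normaliser 0 or \<infinity> the Bochner integral in the denominator is
  0, and division by 0 turns \<open>cond_law\<close> into the zero measure. For all other pasts it
  is a probability measure.\<close>

lemma measure_cond_law_le_1:
  fixes q :: "(nat \<Rightarrow> 'a) \<Rightarrow> real"
  assumes ij: "i < j" "j \<le> n" and q: "q \<in> borel_measurable (pow_measure \<mu> n)"
    and nonneg: "\<And>z. z \<in> space (pow_measure \<mu> n) \<Longrightarrow> 0 \<le> q z"
    and x: "x \<in> space (pow_measure \<mu> i)" and B: "B \<in> sets (PiM {j..n} (\<lambda>_. \<mu>))"
  shows "measure (cond_law \<mu> n q i j x) B \<le> 1"
proof (cases "tail_integral \<mu> n i (\<lambda>z. ennreal (q z)) x \<in> {0, \<infinity>}")
  case False
  have sp: "space (cond_law \<mu> n q i j x) = space (PiM {j..n} (\<lambda>_. \<mu>))" by (simp add: cond_law_def)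
  have 1: "measure (cond_law \<mu> n q i j x) (space (PiM {j..n} (\<lambda>_. \<mu>))) = 1"
    by (rule measure_cond_law_space[OF ij q nonneg x False])
  then have "emeasure (cond_law \<mu> n q i j x) (space (cond_law \<mu> n q i j x)) \<noteq> \<infinity>"
    by (auto simp: measure_def sp)
  then interpret finite_measure "cond_law \<mu> n q i j x" by (rule finite_measureI)
  show ?thesis using bounded_measure[of B] 1 by (simp add: sp)
next
  case True
  let ?J = "PiM {i<..n} (\<lambda>_. \<mu>)" and ?q = "\<lambda>u. q (merge {1..i} {i<..n} (x, u))"
  have i: "i \<le> n" using ij by simp
  note mer = measurable_merge_section[OF i x]
  have "?q \<in> borel_measurable ?J" by (rule measurable_compose[OF mer q])
  then have "(\<integral>v. ?q v \<partial>?J) = enn2real (tail_integral \<mu> n i (\<lambda>z. ennreal (q z)) x)"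
    unfolding tail_integral_def
    by (intro integral_eq_nn_integral) (auto intro!: nonneg measurable_space[OF mer])
  then have I: "(\<integral>v. ?q v \<partial>?J) = 0" using True by auto
  have res: "(\<lambda>u. restrict u {j..n}) \<in> measurable ?J (PiM {j..n} (\<lambda>_. \<mu>))"
    using ij by (intro measurable_restrict_subset) auto
  have "emeasure (cond_law \<mu> n q i j x) B = 0"
    unfolding cond_law_def I using res B measurable_sets[OF res B]
    by (subst emeasure_distr) (auto simp: emeasure_density)
  then show ?thesis by (simp add: measure_def)
qed

lemma eta_bar_pos_le_1:
  assumes kj: "Suc k < j" "j \<le> n" and pdf: "pos_pdf \<mu> n q"
  shows "eta_bar_pos \<mu> n q (Suc k) j \<le> 1"
proof -
  note q = pos_pdf_integrable(2,3)[OF pdf]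
  have ivl: "{1..<Suc k} = {1..k}" by auto
  have "AE (y, w, w') in pow_measure \<mu> k \<Otimes>\<^sub>M (\<mu> \<Otimes>\<^sub>M \<mu>). eta_cond \<mu> n q (Suc k) j y w w' \<le> ereal 1"
    using AE_pow_Suc_pair[OF AE_space[of "pow_measure \<mu> (Suc k)"]]
  proof eventually_elim
    case (elim v)
    obtain y w w' where v: "v = (y, w, w')" by (cases v) auto
    have "eta_cond \<mu> n q (Suc k) j y w w' \<le> ereal 1"
      unfolding eta_cond_def
    proof (rule tv_norm_le)
      fix B assume B: "B \<in> sets (PiM {j..n} (\<lambda>_. \<mu>))"
      have "measure (cond_law \<mu> n q (Suc k) j (y(Suc k := u))) B \<le> 1" if "u \<in> {w, w'}" for u
        using elim that by (intro measure_cond_law_le_1[OF kj q _ B]) (auto simp: v)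
      then show "\<bar>measure (cond_law \<mu> n q (Suc k) j (y(Suc k := w))) B
          - measure (cond_law \<mu> n q (Suc k) j (y(Suc k := w'))) B\<bar> \<le> 1"
        by (smt (verit) insertCI measure_nonneg)
    qed
    then show ?case by (simp add: v)
  qed
  then show ?thesis
    unfolding eta_bar_pos_def ivl by (intro Inf_lower) (simp add: one_ereal_def)
qed

text \<open>A \<sigma>-finite measure admits a strictly positive function of finite integral, to be
  normalised. The function \<open>p\<close> of integral 1 shows that the measure is not zero, hence
  neither is the normaliser.\<close>

lemma ex_pos_pdf:
  fixes p :: "(nat \<Rightarrow> 'a) \<Rightarrow> ennreal"
  assumes "(\<integral>\<^sup>+x. p x \<partial>pow_measure \<mu> n) = 1"
  obtains q where "pos_pdf \<mu> n q"
proof -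
  let ?M = "pow_measure \<mu> n"
  interpret M: sigma_finite_measure ?M by (rule sigma_finite_pow) simp
  obtain h where h: "h \<in> borel_measurable ?M" "integral\<^sup>N ?M h \<noteq> \<infinity>" "\<And>x. x \<in> space ?M \<Longrightarrow> 0 < h x \<and> h x < \<infinity>"
    using M.Ex_finite_integrable_function by auto
  have "integral\<^sup>N ?M h \<noteq> 0"
  proof
    assume "integral\<^sup>N ?M h = 0"
    then have "AE x in ?M. h x = 0" using h(1) by (simp add: nn_integral_0_iff_AE)
    then have "AE x in ?M. p x = 0"
      using AE_space by eventually_elim (use h(3) in force)
    then have "(\<integral>\<^sup>+x. p x \<partial>?M) = (\<integral>\<^sup>+x. 0 \<partial>?M)" by (intro nn_integral_cong_AE) auto
    then show False using assms by simp
  qed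
  then obtain c where c: "integral\<^sup>N ?M h = ennreal c" "0 < c"
    using h(2) by (cases "integral\<^sup>N ?M h") (auto simp: less_le)
  define q where "q = (\<lambda>x. enn2real (h x) / c)"
  have qh: "ennreal (q x) = h x / ennreal c" if "x \<in> space ?M" for x
    using h(3)[OF that] c(2) by (cases "h x") (auto simp: q_def divide_ennreal)
  have "pos_pdf \<mu> n q"
    unfolding pos_pdf_def
  proof (intro conjI ballI)
    show m: "q \<in> borel_measurable ?M" unfolding q_def using h(1) by measurable
    show "0 < q x" if "x \<in> space ?M" for x
      using h(3)[OF that] c(2) by (simp add: q_def enn2real_positive_iff)
    have "(\<integral>\<^sup>+x. ennreal (q x) \<partial>?M) = (\<integral>\<^sup>+x. h x / ennreal c \<partial>?M)"
      by (intro nn_integral_cong qh)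
    also have "\<dots> = 1"
      using h(1) c by (simp add: nn_integral_divide divide_ennreal)
    finally have "(\<integral>\<^sup>+x. ennreal (q x) \<partial>?M) = 1" .
    then show "prob_space (density ?M (\<lambda>x. ennreal (q x)))"
      using m by (intro prob_spaceI) (simp add: emeasure_density cong: nn_integral_cong)
  qed
  then show thesis by (rule that)
qed

text \<open>Mixtures of \<open>p\<close> with a strictly positive density approximate
  \<open>p\<close> in total variation and have coefficients at most 1, so a subsequential limit of
  these is an admissible value.\<close>

lemma eta_bar_le_1:
  fixes p :: "(nat \<Rightarrow> 'a) \<Rightarrow> real"
  assumes kj: "Suc k < j" "j \<le> n" and p: "integrable (pow_measure \<mu> n) p" "\<And>x. 0 \<le> p x"
    and int_p: "(\<integral>\<^sup>+x. ennreal (p x) \<partial>pow_measure \<mu> n) = 1"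
  shows "eta_bar \<mu> n (density (pow_measure \<mu> n) (\<lambda>x. ennreal (p x))) (Suc k) j \<le> 1"
proof -
  let ?M = "pow_measure \<mu> n"
  obtain q where pdf: "pos_pdf \<mu> n q" using ex_pos_pdf[OF int_p] by blast
  note q = pos_pdf_integrable[OF pdf]
  have q0: "0 < q x" if "x \<in> space ?M" for x using pdf that by (simp add: pos_pdf_def)
  have intp: "(\<integral>x. p x \<partial>?M) = 1"
    using int_p p by (simp add: integral_eq_nn_integral)
  have intq: "(\<integral>x. q x \<partial>?M) = 1"
  proof -
    interpret prob_space "density ?M (\<lambda>x. ennreal (q x))"
      using pdf by (simp add: pos_pdf_def)
    show ?thesis
      using prob_space measure_density_real[OF q(2,3) sets.top]
      by (simp cong: Bochner_Integration.integral_cong)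
  qed
  \<comment> \<open>The shift by 2 keeps both weights strictly between 0 and 1 from
    \<open>l = 0\<close> on; the weight of \<open>q\<close> bounds the total variation distance to
    \<open>p\<close>.\<close>
  define f where "f = (\<lambda>l x. (1 - 1 / real (l + 2)) * p x + 1 / real (l + 2) * q x)"
  have fint: "integrable ?M (f l)" for l unfolding f_def using p q by simp
  have fpos: "0 < f l x" if "x \<in> space ?M" for l x
    unfolding f_def using q0[OF that] p(2)[of x] by (intro add_nonneg_pos mult_nonneg_nonneg mult_pos_pos) auto
  have intf: "(\<integral>x. f l x \<partial>?M) = 1" for l
    unfolding f_def using p q by (simp add: intp intq)
  have fpdf: "pos_pdf \<mu> n (f l)" for l
    unfolding pos_pdf_def
  proof (intro conjI ballI fpos)
    show m: "f l \<in> borel_measurable ?M" using fint by simp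
    have "(\<integral>\<^sup>+x. ennreal (f l x) \<partial>?M) = ennreal 1"
      unfolding intf[of l, symmetric] using fpos by (intro nn_integral_eq_integral fint) (auto simp: less_imp_le)
    then show "prob_space (density ?M (\<lambda>x. ennreal (f l x)))"
      using m by (intro prob_spaceI) (simp add: emeasure_density cong: nn_integral_cong)
  qed
  let ?tv = "\<lambda>l. tv_norm ?M (\<lambda>A. measure (density ?M (\<lambda>x. ennreal (f l x))) A - measure (density ?M (\<lambda>x. ennreal (p x))) A)"
  have tv_le: "?tv l \<le> ereal (1 / real (l + 2))" for l
  proof (rule tv_norm_le)
    fix B assume B: "B \<in> sets ?M"
    let ?m = "\<lambda>g. \<integral>x. g x * indicator B x \<partial>?M"
    have i: "integrable ?M (\<lambda>x. p x * indicator B x)" "integrable ?M (\<lambda>x. q x * indicator B x)"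
      using p q B by (auto intro!: integrable_real_mult_indicator)
    have "?m (f l) = (\<integral>x. (1 - 1 / real (l + 2)) * (p x * indicator B x) + 1 / real (l + 2) * (q x * indicator B x) \<partial>?M)"
      by (intro Bochner_Integration.integral_cong) (auto simp: f_def split: split_indicator)
    also have "\<dots> = (1 - 1 / real (l + 2)) * ?m p + 1 / real (l + 2) * ?m q"
      using i by simp
    finally have "?m (f l) - ?m p = 1 / real (l + 2) * (?m q - ?m p)"
      by (simp add: algebra_simps)
    moreover have "0 \<le> ?m p" "0 \<le> ?m q"
      using p(2) q(3) by (auto intro!: Bochner_Integration.integral_nonneg split: split_indicator)
    moreover have "?m p \<le> (\<integral>x. p x \<partial>?M)" "?m q \<le> (\<integral>x. q x \<partial>?M)"
      using p q i by (auto intro!: integral_mono split: split_indicator)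
    then have "?m p \<le> 1" "?m q \<le> 1" by (simp_all only: intp intq)
    ultimately have "\<bar>?m (f l) - ?m p\<bar> \<le> 1 / real (l + 2) * 1"
      by (simp only: abs_mult) (intro mult_mono; auto)
    then show "\<bar>measure (density ?M (\<lambda>x. ennreal (f l x))) B - measure (density ?M (\<lambda>x. ennreal (p x))) B\<bar> \<le> 1 / real (l + 2)"
      using B fint[of l] p fpos[of _ l] by (simp add: measure_density_real less_imp_le)
  qed
  have lim0: "(\<lambda>l. ereal (1 / real (l + 2))) \<longlonglongrightarrow> 0"
    unfolding zero_ereal_def
    using LIMSEQ_ignore_initial_segment[OF lim_1_over_n, of 2] by (intro tendsto_ereal) simp
  have tv: "?tv \<longlonglongrightarrow> 0"
  proof (rule tendsto_sandwich[OF _ _ tendsto_const lim0]; intro always_eventually allI)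
    show "0 \<le> ?tv l" for l by (rule tv_norm_nonneg) simp
    show "?tv l \<le> ereal (1 / real (l + 2))" for l by (rule tv_le)
  qed
  \<comment> \<open>\<open>eta_bar\<close> admits only sequences whose coefficients converge;
    compactness of the extended reals supplies one.\<close>
  obtain L r where r: "strict_mono r" and L: "((\<lambda>l. eta_bar_pos \<mu> n (f l) (Suc k) j) \<circ> r) \<longlonglongrightarrow> L"
    using compact_complete_linorder[of "\<lambda>l. eta_bar_pos \<mu> n (f l) (Suc k) j"] by blast
  have "L \<le> 1"
    by (rule LIMSEQ_le_const2[OF L]) (simp add: eta_bar_pos_le_1[OF kj fpdf])
  moreover have "eta_bar \<mu> n (density ?M (\<lambda>x. ennreal (p x))) (Suc k) j \<le> L"
    unfolding eta_bar_def
  proof (rule Inf_lower, rule CollectI, rule exI[of _ "\<lambda>l. f (r l)"], intro conjI allI)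
    show "(\<lambda>l. ?tv (r l)) \<longlonglongrightarrow> 0" using LIMSEQ_subseq_LIMSEQ[OF tv r] by (simp add: comp_def)
    show "(\<lambda>l. eta_bar_pos \<mu> n (f (r l)) (Suc k) j) \<longlonglongrightarrow> L" using L by (simp add: comp_def)
  qed (rule fpdf)
  ultimately show ?thesis by simp
qed

text \<open>The bound with excess \<open>1 / real (Suc l)\<close> holds for all \<open>l\<close> at
  once off one null set, and \<open>l\<close> then tends to infinity.\<close>

lemma AE_tail_prob_diff_le_eta_bar:
  fixes p :: "(nat \<Rightarrow> 'a) \<Rightarrow> real"
  assumes kj: "Suc k < j" "j \<le> n" and p: "integrable (pow_measure \<mu> n) p" "\<And>x. 0 \<le> p x"
    and int_p: "(\<integral>\<^sup>+x. ennreal (p x) \<partial>pow_measure \<mu> n) = 1" and A: "A \<in> sets \<mu>"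
  defines "P \<equiv> \<lambda>z. ennreal (p z)"
  shows "AE (y, w, w') in pow_measure \<mu> k \<Otimes>\<^sub>M (\<mu> \<Otimes>\<^sub>M \<mu>).
      tail_integral \<mu> n (Suc k) P (y(Suc k := w)) \<notin> {0, \<infinity>} \<longrightarrow>
      tail_integral \<mu> n (Suc k) P (y(Suc k := w')) \<notin> {0, \<infinity>} \<longrightarrow>
      \<bar>tail_prob \<mu> n P (Suc k) j A (y(Suc k := w)) - tail_prob \<mu> n P (Suc k) j A (y(Suc k := w'))\<bar>
        \<le> real_of_ereal (eta_bar \<mu> n (density (pow_measure \<mu> n) P) (Suc k) j)"
proof -
  let ?e = "eta_bar \<mu> n (density (pow_measure \<mu> n) P) (Suc k) j"
  \<comment> \<open>This excludes \<infinity>, where \<open>real_of_ereal\<close> would return 0 and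
    the strict inequality would fail.\<close>
  have "?e \<le> 1" unfolding P_def by (rule eta_bar_le_1[OF kj p int_p])
  then have lt: "?e < ereal (real_of_ereal ?e + 1 / real (Suc l))" for l
    by (cases ?e) auto
  have "AE v in pow_measure \<mu> k \<Otimes>\<^sub>M (\<mu> \<Otimes>\<^sub>M \<mu>). \<forall>l. case v of (y, w, w') \<Rightarrow>
      tail_integral \<mu> n (Suc k) P (y(Suc k := w)) \<notin> {0, \<infinity>} \<longrightarrow>
      tail_integral \<mu> n (Suc k) P (y(Suc k := w')) \<notin> {0, \<infinity>} \<longrightarrow>
      \<bar>tail_prob \<mu> n P (Suc k) j A (y(Suc k := w)) - tail_prob \<mu> n P (Suc k) j A (y(Suc k := w'))\<bar>
        \<le> real_of_ereal ?e + 1 / real (Suc l)"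
    unfolding AE_all_countable P_def
    by (intro allI AE_tail_prob_diff_le[OF kj p A lt[unfolded P_def]])
  then show ?thesis
  proof eventually_elim
    case (elim v)
    have lim: "(\<lambda>l. real_of_ereal ?e + 1 / real (Suc l)) \<longlonglongrightarrow> real_of_ereal ?e + 0"
      using LIMSEQ_Suc[OF lim_1_over_n] by (intro tendsto_add tendsto_const) simp
    have "z \<le> real_of_ereal ?e" if "\<And>l. z \<le> real_of_ereal ?e + 1 / real (Suc l)" for z
      using LIMSEQ_le_const[OF lim, of z] that by auto
    then show ?case using elim by (auto split: prod.splits)
  qed
qed

section \<open>Row sums of the mixing matrix as bounds on martingale differences\<close>

lemma linf_norm_Delta_ge_row:
  assumes "i \<in> {1..n}"
  shows "(\<Sum>j=1..n. Delta \<mu> n m i j) \<le> linf_norm n (Delta \<mu> n m)"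
proof -
  have "(\<Sum>j=1..n. Delta \<mu> n m i j) \<le> (\<Sum>j=1..n. \<bar>Delta \<mu> n m i j\<bar>)" by (intro sum_mono) simp
  also have "\<dots> \<le> linf_norm n (Delta \<mu> n m)" unfolding linf_norm_def using assms by (intro Max_ge) auto
  finally show ?thesis .
qed

lemma Delta_nonneg: "0 \<le> Delta \<mu> n m i j"
  by (simp add: Delta_def real_eta_bar_nonneg)

text \<open>Row 1 has nonnegative entries and a 1 on the diagonal. In particular the denominator of
  the final exponent is positive.\<close>

lemma linf_norm_Delta_ge_1:
  assumes "1 \<le> n"
  shows "1 \<le> linf_norm n (Delta \<mu> n m)"
proof -
  have "Delta \<mu> n m 1 1 \<le> (\<Sum>j=1..n. Delta \<mu> n m 1 j)"
    using assms by (intro member_le_sum Delta_nonneg) auto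
  also have "\<dots> \<le> linf_norm n (Delta \<mu> n m)"
    using assms by (intro linf_norm_Delta_ge_row) auto
  finally show ?thesis by (simp add: Delta_def)
qed

text \<open>Term by term comparison with row \<open>Suc k\<close>: entry 0 for observed coordinates,
  the diagonal 1 for the altered coordinate, and a mixing coefficient for each later one.\<close>

lemma AE_sum_tail_prob_diff_le:
  fixes p :: "(nat \<Rightarrow> 'a) \<Rightarrow> real"
  assumes k: "k < n" and p: "integrable (pow_measure \<mu> n) p" "\<And>x. 0 \<le> p x"
    and int_p: "(\<integral>\<^sup>+x. ennreal (p x) \<partial>pow_measure \<mu> n) = 1" and A: "A \<in> sets \<mu>"
  defines "P \<equiv> \<lambda>z. ennreal (p z)"
  shows "AE (y, w, w') in pow_measure \<mu> k \<Otimes>\<^sub>M (\<mu> \<Otimes>\<^sub>M \<mu>).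
      tail_integral \<mu> n (Suc k) P (y(Suc k := w)) \<notin> {0, \<infinity>} \<longrightarrow>
      tail_integral \<mu> n (Suc k) P (y(Suc k := w')) \<notin> {0, \<infinity>} \<longrightarrow>
      \<bar>(\<Sum>j=1..n. tail_prob \<mu> n P (Suc k) j A (y(Suc k := w)))
        - (\<Sum>j=1..n. tail_prob \<mu> n P (Suc k) j A (y(Suc k := w')))\<bar>
        \<le> linf_norm n (Delta \<mu> n (density (pow_measure \<mu> n) P))"
proof -
  let ?m = "density (pow_measure \<mu> n) P" and ?t = "\<lambda>j. tail_prob \<mu> n P (Suc k) j A"
  have Pm: "P \<in> borel_measurable (pow_measure \<mu> n)" unfolding P_def using p(1) by measurable
  have "AE v in pow_measure \<mu> k \<Otimes>\<^sub>M (\<mu> \<Otimes>\<^sub>M \<mu>). \<forall>j\<in>{Suc k<..n}. case v of (y, w, w') \<Rightarrow>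
      tail_integral \<mu> n (Suc k) P (y(Suc k := w)) \<notin> {0, \<infinity>} \<longrightarrow>
      tail_integral \<mu> n (Suc k) P (y(Suc k := w')) \<notin> {0, \<infinity>} \<longrightarrow>
      \<bar>?t j (y(Suc k := w)) - ?t j (y(Suc k := w'))\<bar> \<le> real_of_ereal (eta_bar \<mu> n ?m (Suc k) j)"
    unfolding P_def
    by (intro AE_finite_allI AE_tail_prob_diff_le_eta_bar p int_p A) auto
  moreover note AE_pow_Suc_pair[OF AE_space[of "pow_measure \<mu> (Suc k)"]]
  ultimately show ?thesis
  proof eventually_elim
    case (elim v)
    obtain y w w' where v: "v = (y, w, w')" by (cases v) auto
    let ?x = "y(Suc k := w)" and ?x' = "y(Suc k := w')"
    have "\<bar>(\<Sum>j=1..n. ?t j ?x) - (\<Sum>j=1..n. ?t j ?x')\<bar> \<le> linf_norm n (Delta \<mu> n ?m)"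
      if D: "tail_integral \<mu> n (Suc k) P ?x \<notin> {0, \<infinity>}" "tail_integral \<mu> n (Suc k) P ?x' \<notin> {0, \<infinity>}"
    proof -
      have x: "?x \<in> space (pow_measure \<mu> (Suc k))" "?x' \<in> space (pow_measure \<mu> (Suc k))"
        using elim(2) by (auto simp: v)
      have "\<bar>?t j ?x - ?t j ?x'\<bar> \<le> Delta \<mu> n ?m (Suc k) j" if j: "j \<in> {1..n}" for j
      proof -
        consider "j < Suc k" | "j = Suc k" | "Suc k < j" by linarith
        then show ?thesis
        proof cases
          case 1
          \<comment> \<open>The two pasts differ only at \<open>Suc k\<close>, so they share the
            value \<open>y j\<close>.\<close>
          then have "?t j ?x = indicator A (y j)" "?t j ?x' = indicator A (y j)"
            using j k D by (auto simp: tail_prob_past[OF _ Pm x(1)] tail_prob_past[OF _ Pm x(2)])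
          then show ?thesis by (simp add: Delta_nonneg)
        next
          case 2
          then show ?thesis
            using tail_prob_nonneg[of n P "Suc k" j A] tail_prob_le_1[of n P "Suc k" j A]
            by (simp add: Delta_def abs_le_iff) (smt (verit))
        next
          case 3
          then show ?thesis using elim(1) j D by (auto simp: v Delta_def)
        qed
      qed
      then have "(\<Sum>j=1..n. \<bar>?t j ?x - ?t j ?x'\<bar>) \<le> (\<Sum>j=1..n. Delta \<mu> n ?m (Suc k) j)"
        by (rule sum_mono)
      also have "\<dots> \<le> linf_norm n (Delta \<mu> n ?m)" using k by (intro linf_norm_Delta_ge_row) auto
      finally show ?thesis
        using sum_abs[of "\<lambda>j. ?t j ?x - ?t j ?x'" "{1..n}"] by (simp add: sum_subtractf)
    qed
    then show ?case by (auto simp: v)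
  qed
qed

subsection \<open>The empirical measure\<close>

lemma emp_measure_upper_tail:
  fixes p :: "(nat \<Rightarrow> 'a) \<Rightarrow> real"
  assumes n: "1 \<le> n" and p: "integrable (pow_measure \<mu> n) p" "\<And>x. 0 \<le> p x"
    and int_p: "(\<integral>\<^sup>+x. ennreal (p x) \<partial>pow_measure \<mu> n) = 1" and A: "A \<in> sets \<mu>" and t: "0 < t"
  defines "m \<equiv> density (pow_measure \<mu> n) (\<lambda>z. ennreal (p z))"
  shows "measure m {x \<in> space (pow_measure \<mu> n). emp_measure n x A
      - 1 / real n * (\<Sum>j=1..n. measure m {z \<in> space (pow_measure \<mu> n). z j \<in> A}) > t}
    \<le> exp (- (real n * t\<^sup>2 / (2 * (linf_norm n (Delta \<mu> n m))\<^sup>2)))"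
proof -
  let ?s = "\<Sum>j=1..n. measure m {z \<in> space (pow_measure \<mu> n). z j \<in> A}"
  have Pm: "(\<lambda>z. ennreal (p z)) \<in> borel_measurable (pow_measure \<mu> n)" using p(1) by measurable
  have "0 < linf_norm n (Delta \<mu> n m)" using linf_norm_Delta_ge_1[OF n] by (rule less_le_trans[OF zero_less_one])
  then have "measure m {x \<in> space (pow_measure \<mu> n). (\<Sum>j=1..n. indicator A (x j)) - ?s > real n * t}
    \<le> exp (- (real n * t\<^sup>2 / (2 * (linf_norm n (Delta \<mu> n m))\<^sup>2)))"
    unfolding m_def
    by (intro sum_indicator_concentration[OF Pm int_p A t] AE_sum_tail_prob_diff_le[OF _ p int_p A])
  moreover have "(\<Sum>j=1..n. indicator A (x j)) - ?s > real n * t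
      \<longleftrightarrow> emp_measure n x A - 1 / real n * ?s > t" for x
    using n by (simp add: emp_measure_def field_simps)
  ultimately show ?thesis by simp
qed

end

section \<open>Complements and the total mass of the limit\<close>

lemma emp_measure_compl:
  assumes "1 \<le> n" "\<And>i. i \<in> {1..n} \<Longrightarrow> x i \<in> S"
  shows "emp_measure n x (S - A) = 1 - emp_measure n x A"
proof -
  have "(\<Sum>i=1..n. indicator (S - A) (x i)) = (\<Sum>i=1..n. 1 - indicator A (x i) :: real)"
    using assms(2) by (intro sum.cong) (auto split: split_indicator)
  then show ?thesis
    using assms(1) by (simp add: emp_measure_def sum_subtractf field_simps)
qed

lemma emp_measure_restrict: "emp_measure n (\<lambda>i\<in>{1..n}. x i) A = emp_measure n x A"
  unfolding emp_measure_def by simp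

text \<open>The whole space and the empty set together bound the norm below by half the defect
  \<open>\<bar>1 - \<nu> (space M)\<bar>\<close>, which does not depend on \<open>n\<close>.\<close>

lemma tv_norm_tendsto_0_imp_total_mass_1:
  assumes "(\<lambda>n. tv_norm M (\<lambda>A. \<tau> n A - \<nu> A)) \<longlonglongrightarrow> 0"
    and one: "\<And>n. 1 \<le> n \<Longrightarrow> \<tau> n (space M) = 1" and empty: "\<And>n. \<tau> n {} = 0" "\<nu> {} = 0"
  shows "\<nu> (space M) = (1::real)"
proof (rule ccontr)
  assume ne: "\<nu> (space M) \<noteq> 1"
  define d where "d = \<bar>1 - \<nu> (space M)\<bar> / 2"
  have d: "0 < d" using ne by (simp add: d_def)
  have "ereal d \<le> tv_norm M (\<lambda>A. \<tau> n A - \<nu> A)" if "1 \<le> n" for n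
    using half_diff_le_tv_norm[of "space M" M "{}" "\<lambda>A. \<tau> n A - \<nu> A"]
      half_diff_le_tv_norm[of "{}" M "space M" "\<lambda>A. \<tau> n A - \<nu> A"] one[OF that] empty
    by (auto simp: d_def abs_if)
  then have "ereal d \<le> 0"
    using LIMSEQ_le_const[OF assms(1)] by blast
  then show False using d by simp
qed

section \<open>Two-sided tail bound and almost sure convergence\<close>

text \<open>Almost sure convergence is stated under summability of the bounds because the norms may
  grow with \<open>n\<close>: if their squares grow linearly, the bounds do not even tend to
  0.\<close>

theorem theorem4p1:
  fixes \<mu> \<nu> :: "'a::topological_space measure"
    and P :: "(nat \<Rightarrow> 'a) measure"
    and X :: "nat \<Rightarrow> (nat \<Rightarrow> 'a) \<Rightarrow> 'a"
    and n0 :: "real \<Rightarrow> nat"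
  assumes borel: "sets \<mu> = sets borel"
    and sigma_finite: "sigma_finite_measure \<mu>"
    and dominated: "\<And>n. 1 \<le> n \<Longrightarrow> Psi_dominated \<mu> n (hamming n)"
    and prob: "prob_space P"
    and sets_P: "sets P = sets (PiM {1..} (\<lambda>_. \<mu>))"
    and X: "\<And>i. 1 \<le> i \<Longrightarrow> X i \<in> measurable P \<mu>"
    and abs_cont: "\<And>n. 1 \<le> n \<Longrightarrow> absolutely_continuous (pow_measure \<mu> n) (marginal \<mu> P X n)"
    and sets_nu: "sets \<nu> = sets \<mu>"
    and unif_conv: "(\<lambda>n. tv_norm \<mu> (\<lambda>A. (\<integral>\<omega>. emp_measure n (\<lambda>i. X i \<omega>) A \<partial>P) - measure \<nu> A))
                      \<longlonglongrightarrow> 0"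
    and n0: "\<And>\<epsilon> n. 0 < \<epsilon> \<Longrightarrow> n0 \<epsilon> < n \<Longrightarrow>
               tv_norm \<mu> (\<lambda>A. (\<integral>\<omega>. emp_measure n (\<lambda>i. X i \<omega>) A \<partial>P) - measure \<nu> A) < ereal \<epsilon>"
    and A: "A \<in> sets \<mu>"
  shows "(\<forall>t>0. \<forall>\<epsilon>>0. \<forall>n>n0 \<epsilon>.
            measure (marginal \<mu> P X n)
              {x \<in> space (pow_measure \<mu> n). \<bar>emp_measure n x A - measure \<nu> A\<bar> > t + \<epsilon>}
            \<le> 2 * exp (- (real n * t\<^sup>2 / (2 * (linf_norm n (Delta \<mu> n (marginal \<mu> P X n)))\<^sup>2))))
       \<and> ((\<forall>t>0. summable (\<lambda>n. exp (- (real n * t\<^sup>2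
                    / (2 * (linf_norm n (Delta \<mu> n (marginal \<mu> P X n)))\<^sup>2)))))
          \<longrightarrow> (AE \<omega> in P. (\<lambda>n. emp_measure n (\<lambda>i. X i \<omega>) A) \<longlonglongrightarrow> measure \<nu> A))"
proof -
  note [simp del] = One_nat_def
  interpret P: prob_space P by (rule prob)
  let ?K = "\<lambda>n. linf_norm n (Delta \<mu> n (marginal \<mu> P X n))"
  let ?EP = "\<lambda>n A. \<integral>\<omega>. emp_measure n (\<lambda>i. X i \<omega>) A \<partial>P"
  let ?B = "\<lambda>n A s. {x \<in> space (pow_measure \<mu> n). \<bar>emp_measure n x A - measure \<nu> A\<bar> > s}"
  have Xn: "(\<lambda>\<omega>. \<lambda>i\<in>{1..n}. X i \<omega>) \<in> measurable P (pow_measure \<mu> n)" for n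
    using X by (intro measurable_restrict) auto
  have Xsp: "X i \<omega> \<in> space \<mu>" if "\<omega> \<in> space P" "1 \<le> i" for i \<omega>
    using measurable_space[OF X] that by auto
  have indX: "integrable P (\<lambda>\<omega>. indicator C (X j \<omega>) :: real)" if "C \<in> sets \<mu>" "1 \<le> j" for C j
    using that by (intro P.integrable_const_bound[where B = 1])
      (auto intro!: measurable_compose[OF X borel_measurable_indicator] split: split_indicator)
  have emp_int: "integrable P (\<lambda>\<omega>. emp_measure n (\<lambda>i. X i \<omega>) C)" if "C \<in> sets \<mu>" for C n
    unfolding emp_measure_def using that
    by (intro integrable_mult_right Bochner_Integration.integrable_sum indX) auto
  \<comment> \<open>This writes the expectation as the centring used in
    \<open>emp_measure_upper_tail\<close>.\<close>
  have EP: "?EP n C = 1 / real n * (\<Sum>j=1..n. measure (marginal \<mu> P X n) {z \<in> space (pow_measure \<mu> n). z j \<in> C})"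
    if C: "C \<in> sets \<mu>" for n C
  proof -
    have "(\<integral>\<omega>. indicator C (X j \<omega>) \<partial>P) = measure (marginal \<mu> P X n) {z \<in> space (pow_measure \<mu> n). z j \<in> C}"
      if j: "j \<in> {1..n}" for j
    proof -
      have j1: "1 \<le> j" using j by simp
      have "{z \<in> space (pow_measure \<mu> n). z j \<in> C} \<in> sets (pow_measure \<mu> n)"
        using C j by measurable
      then have "measure (marginal \<mu> P X n) {z \<in> space (pow_measure \<mu> n). z j \<in> C}
        = measure P ((\<lambda>\<omega>. \<lambda>i\<in>{1..n}. X i \<omega>) -` {z \<in> space (pow_measure \<mu> n). z j \<in> C} \<inter> space P)"
        unfolding marginal_def by (intro measure_distr[OF Xn])
      also have "(\<lambda>\<omega>. \<lambda>i\<in>{1..n}. X i \<omega>) -` {z \<in> space (pow_measure \<mu> n). z j \<in> C} \<inter> space P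
        = X j -` C \<inter> space P"
        using j measurable_space[OF Xn] by auto
      also have "measure P \<dots> = (\<integral>\<omega>. indicator (X j -` C \<inter> space P) \<omega> \<partial>P)"
        by simp
      also have "\<dots> = (\<integral>\<omega>. indicator C (X j \<omega>) \<partial>P)"
        by (intro Bochner_Integration.integral_cong) (auto split: split_indicator)
      finally show ?thesis by simp
    qed
    then have "(\<Sum>j=1..n. \<integral>\<omega>. indicator C (X j \<omega>) \<partial>P)
        = (\<Sum>j=1..n. measure (marginal \<mu> P X n) {z \<in> space (pow_measure \<mu> n). z j \<in> C})"
      by (rule sum.cong[OF refl])
    moreover have "?EP n C = 1 / real n * (\<Sum>j=1..n. \<integral>\<omega>. indicator C (X j \<omega>) \<partial>P)"
      unfolding emp_measure_def using C indX
      by (subst integral_mult_right_zero, subst Bochner_Integration.integral_sum) auto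
    ultimately show ?thesis by simp
  qed
  have EP_compl: "?EP n (space \<mu> - C) = 1 - ?EP n C" if C: "C \<in> sets \<mu>" and n: "1 \<le> n" for n C
  proof -
    have "?EP n (space \<mu> - C) = (\<integral>\<omega>. 1 - emp_measure n (\<lambda>i. X i \<omega>) C \<partial>P)"
      using Xsp by (intro Bochner_Integration.integral_cong refl emp_measure_compl n) auto
    then show ?thesis using emp_int[OF C] by (simp add: P.prob_space)
  qed
  have nu_space: "measure \<nu> (space \<mu>) = 1"
  proof (rule tv_norm_tendsto_0_imp_total_mass_1[OF unif_conv])
    show "?EP n {} = 0" for n by (simp add: emp_measure_def)
    then show "?EP n (space \<mu>) = 1" if "1 \<le> n" for n
      using EP_compl[OF sets.empty_sets that] by simp
  qed simp
  have sp: "space \<nu> = space \<mu>" by (rule sets_eq_imp_space_eq[OF sets_nu])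
  \<comment> \<open>A measure of infinite mass would have \<open>measure\<close> equal to 0 on the
    whole space, not 1.\<close>
  have "emeasure \<nu> (space \<nu>) \<noteq> \<infinity>"
    using nu_space by (auto simp: measure_def sp)
  then interpret nu: finite_measure \<nu> by (rule finite_measureI)
  have nu_compl: "measure \<nu> (space \<mu> - A) = 1 - measure \<nu> A"
    using nu.finite_measure_compl[of A] A nu_space by (simp add: sp sets_nu)
  \<comment> \<open>The expected empirical measure and \<open>\<nu>\<close> both have mass 1, so
    their difference changes sign on the complement and the norm bounds it without a factor
    2.\<close>
  have bias: "\<bar>?EP n A - measure \<nu> A\<bar> < \<epsilon>" if "0 < \<epsilon>" "n0 \<epsilon> < n" for \<epsilon> n
  proof -
    have "ereal \<bar>?EP n A - measure \<nu> A\<bar> \<le> tv_norm \<mu> (\<lambda>A. ?EP n A - measure \<nu> A)"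
      using that A EP_compl[OF A, of n] nu_compl by (intro abs_le_tv_norm) auto
    also have "\<dots> < ereal \<epsilon>" by (rule n0[OF that])
    finally show ?thesis by simp
  qed
  have emp_meas: "(\<lambda>x. emp_measure n x A) \<in> borel_measurable (pow_measure \<mu> n)" for n
    unfolding emp_measure_def
    by (intro borel_measurable_times borel_measurable_const borel_measurable_sum
        measurable_compose[OF measurable_component_singleton borel_measurable_indicator] A)
  have tail: "measure (marginal \<mu> P X n) (?B n A (t + \<epsilon>)) \<le> 2 * exp (- (real n * t\<^sup>2 / (2 * (?K n)\<^sup>2)))"
    if t: "0 < t" and e: "0 < \<epsilon>" and n: "n0 \<epsilon> < n" for t \<epsilon> n
  proof -
    let ?M = "pow_measure \<mu> n" and ?m = "marginal \<mu> P X n"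
    have n1: "1 \<le> n" using n by simp
    interpret m: prob_space ?m
      unfolding marginal_def by (rule P.prob_space_distr[OF Xn])
    interpret M: sigma_finite_measure ?M by (rule sigma_finite_pow[OF sigma_finite]) simp
    have sets_m: "sets ?m = sets ?M" by (simp add: marginal_def)
    \<comment> \<open>A finite, everywhere nonnegative version of the Radon-Nikodym derivative:
      mixtures and L1 differences are formed with real densities.\<close>
    obtain p where pm: "p \<in> borel_measurable ?M" and RN: "AE x in ?M. RN_deriv ?M ?m x = ennreal (p x)"
      and "AE x in ?m. 0 < p x" and p0: "\<And>x. 0 \<le> p x"
      by (rule M.real_RN_deriv[OF m.finite_measure_axioms abs_cont[OF n1] sets_m]) blast
    have m: "density ?M (\<lambda>x. ennreal (p x)) = ?m"
    proof -
      have "density ?M (\<lambda>x. ennreal (p x)) = density ?M (RN_deriv ?M ?m)"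
        using pm RN by (intro density_cong) (auto elim!: eventually_mono)
      also have "\<dots> = ?m" by (rule M.density_RN_deriv[OF abs_cont[OF n1] sets_m])
      finally show ?thesis .
    qed
    have int_p: "(\<integral>\<^sup>+x. ennreal (p x) \<partial>?M) = 1"
    proof -
      have "(\<integral>\<^sup>+x. ennreal (p x) \<partial>?M) = emeasure (density ?M (\<lambda>x. ennreal (p x))) (space ?M)"
        using pm by (simp add: emeasure_density cong: nn_integral_cong)
      also have "\<dots> = 1"
        unfolding m using m.emeasure_space_1 by (simp add: sets_eq_imp_space_eq[OF sets_m])
      finally show ?thesis .
    qed
    have pint: "integrable ?M p" using pm p0 int_p by (intro integrableI_nonneg) auto
    let ?U = "\<lambda>C. {x \<in> space ?M. emp_measure n x C - ?EP n C > t}"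
    have U: "measure ?m (?U C) \<le> exp (- (real n * t\<^sup>2 / (2 * (?K n)\<^sup>2)))" if C: "C \<in> sets \<mu>" for C
      using emp_measure_upper_tail[OF sigma_finite n1 pint p0 int_p C t] unfolding m EP[OF C] .
    have Ac: "space \<mu> - A \<in> sets \<mu>" using A by simp
    have compl: "emp_measure n x (space \<mu> - A) = 1 - emp_measure n x A" if "x \<in> space ?M" for x
      using that by (intro emp_measure_compl n1) (auto simp: space_PiM)
    \<comment> \<open>The bias uses up \<epsilon>, leaving a deviation above \<open>t\<close> from
      the expectation. For the complement both the empirical measure and its expectation become 1
      minus their values, so a deviation below is one above.\<close>
    have "?B n A (t + \<epsilon>) \<subseteq> ?U A \<union> ?U (space \<mu> - A)"
      using bias[OF e n] compl EP_compl[OF A n1] by (auto simp: abs_if split: if_splits)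
    moreover have UA: "?U A \<in> sets ?m" using emp_meas[of n] unfolding sets_m by measurable
    moreover have UAc: "?U (space \<mu> - A) \<in> sets ?m"
    proof -
      have "?U (space \<mu> - A) = {x \<in> space ?M. 1 - emp_measure n x A - ?EP n (space \<mu> - A) > t}"
        using compl by auto
      also have "\<dots> \<in> sets ?m" using emp_meas[of n] unfolding sets_m by measurable
      finally show ?thesis .
    qed
    ultimately have "measure ?m (?B n A (t + \<epsilon>)) \<le> measure ?m (?U A \<union> ?U (space \<mu> - A))"
      by (intro m.finite_measure_mono) auto
    also have "\<dots> \<le> measure ?m (?U A) + measure ?m (?U (space \<mu> - A))"
      by (rule measure_Un_le[OF UA UAc])
    also have "\<dots> \<le> 2 * exp (- (real n * t\<^sup>2 / (2 * (?K n)\<^sup>2)))"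
      using U[OF A] U[OF Ac] by simp
    finally show ?thesis .
  qed
  have conv: "AE \<omega> in P. (\<lambda>n. emp_measure n (\<lambda>i. X i \<omega>) A) \<longlonglongrightarrow> measure \<nu> A"
    if summ: "\<And>t. 0 < t \<Longrightarrow> summable (\<lambda>n. exp (- (real n * t\<^sup>2 / (2 * (?K n)\<^sup>2))))"
  proof -
    have "AE \<omega> in P. \<forall>\<^sub>F n in sequentially. \<bar>emp_measure n (\<lambda>i. X i \<omega>) A - measure \<nu> A\<bar> \<le> 2 * s"
      if s: "0 < s" for s
    proof -
      \<comment> \<open>The tail bound is used with \<open>t = \<epsilon> = s\<close>.\<close>
      let ?C = "\<lambda>n. {\<omega> \<in> space P. \<bar>emp_measure n (\<lambda>i. X i \<omega>) A - measure \<nu> A\<bar> > s + s}"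
      have C: "?C n \<in> sets P" for n
        using borel_measurable_integrable[OF emp_int[OF A, of n]] by measurable
      have meas: "measure P (?C n) = measure (marginal \<mu> P X n) (?B n A (s + s))" for n
      proof -
        have "?B n A (s + s) \<in> sets (pow_measure \<mu> n)" using emp_meas[of n] by measurable
        then have "measure (marginal \<mu> P X n) (?B n A (s + s))
          = measure P ((\<lambda>\<omega>. \<lambda>i\<in>{1..n}. X i \<omega>) -` ?B n A (s + s) \<inter> space P)"
          unfolding marginal_def by (rule measure_distr[OF Xn])
        also have "(\<lambda>\<omega>. \<lambda>i\<in>{1..n}. X i \<omega>) -` ?B n A (s + s) \<inter> space P = ?C n"
          using measurable_space[OF Xn[of n]] by (auto simp: emp_measure_restrict simp del: One_nat_def)
        finally show ?thesis ..
      qed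
      have "summable (\<lambda>n. measure P (?C n))"
      proof (rule summable_comparison_test_ev)
        show "summable (\<lambda>n. 2 * exp (- (real n * s\<^sup>2 / (2 * (?K n)\<^sup>2))))"
          by (rule summable_mult[OF summ[OF s]])
        \<comment> \<open>The bound holds only beyond \<open>n0 s\<close>, so the comparison is
          eventual.\<close>
        show "\<forall>\<^sub>F n in sequentially. norm (measure P (?C n)) \<le> 2 * exp (- (real n * s\<^sup>2 / (2 * (?K n)\<^sup>2)))"
          using eventually_gt_at_top[of "n0 s"]
        proof eventually_elim
          case (elim n)
          show ?case unfolding meas using tail[OF s s elim] by simp
        qed
      qed
      then have "AE \<omega> in P. \<forall>\<^sub>F n in sequentially. \<omega> \<in> space P - ?C n"
        using C by (intro borel_cantelli_AE1) (auto simp: P.emeasure_eq_measure)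
      then show ?thesis
      proof eventually_elim
        case (elim \<omega>)
        then show ?case by eventually_elim auto
      qed
    qed
    \<comment> \<open>Countably many tolerances suffice, and their null sets can be united.\<close>
    then have "AE \<omega> in P. \<forall>l. \<forall>\<^sub>F n in sequentially. \<bar>emp_measure n (\<lambda>i. X i \<omega>) A - measure \<nu> A\<bar> \<le> 2 * (1 / real (Suc l))"
      unfolding AE_all_countable by (meson zero_less_divide_1_iff of_nat_0_less_iff zero_less_Suc)
    then show ?thesis
    proof eventually_elim
      case (elim \<omega>)
      show ?case
      proof (rule tendstoI)
        fix e :: real assume "0 < e"
        then obtain l where l: "1 / real (Suc l) < e / 2"
          using nat_approx_posE[of "e / 2"] by auto
        show "\<forall>\<^sub>F n in sequentially. dist (emp_measure n (\<lambda>i. X i \<omega>) A) (measure \<nu> A) < e"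
          using elim[rule_format, of l] by eventually_elim (use l in \<open>simp add: dist_real_def\<close>)
      qed
    qed
  qed
  show ?thesis
    by (intro conjI allI impI tail conv) simp_all
qed

end
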